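(* Let $n\ge1$ be an integer and let $\mathcal L$ be a linear operator generating an analytic semigroup $\{e^{-t\mathcal L}\}_{t>0}$ on $L^2(\mathbb R^n)$ whose kernel $p_t(x,y)$ satisfies a Gaussian upper bound: there are constants $C_0,A>0$ with $|p_t(x,y)|\le C_0\,t^{-n/2}e^{-A|x-y|^2/t}$ for all $x,y\in\mathbb R^n$ and $t>0$. Let $0<\gamma<n$, $q=n/(n-\gamma)$ and $w\in A_{1,q}$. Assume that $1\le\alpha<\beta<s\le\infty$ with $1/\beta=1/\alpha-\gamma/n$, and that $\mu\in\Delta_2$. Then the generalized fractional integral $\mathcal L^{-\gamma/2}$ is bounded from $(L^1,L^s)^{\alpha}(w,w^q;\mu)$ into $(WL^q,L^s)^{\beta}(w^q;\mu)$; that is, there is a constant $C>0$ independent of $f$ such that $\|\mathcal L^{-\gamma/2}f\|_{(WL^q,L^s)^{\beta}(w^q;\mu)}\le C\|f\|_{(L^1,L^s)^{\alpha}(w,w^q;\mu)}$ for all $f\in(L^1,L^s)^{\alpha}(w,w^q;\mu)$.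
   Context: A weight is a non-negative locally integrable function on $\mathbb R^n$; for a weight $w$ and measurable $E$, $w(E)=\int_E w(x)\,dx$, and $w^q(E)=\int_E w(x)^q\,dx$. $B(y,r)$ is the open Euclidean ball with center $y$ and radius $r$. The semigroup acts by $e^{-t\mathcal L}f(x)=\int_{\mathbb R^n}p_t(x,y)f(y)\,dy$. Generalized fractional integral: $\mathcal L^{-\gamma/2}f(x)=\frac1{\Gamma(\gamma/2)}\int_0^\infty e^{-t\mathcal L}f(x)\,t^{\gamma/2-1}\,dt$, i.e. the integral operator with kernel $\mathcal K_\gamma(x,y)=\frac1{\Gamma(\gamma/2)}\int_0^\infty p_t(x,y)t^{\gamma/2-1}\,dt$. For $1<q<\infty$, $w\in A_{1,q}$ means: there is $C>0$ such that for every ball $B$, $\left(\frac1{|B|}\int_B w^q\,dx\right)^{1/q}\left(\operatorname{ess\,sup}_{x\in B}\frac1{w(x)}\right)\le C$. $\mu\in\Delta_2$ means that $\mu$ is a weight and there is $C>0$ with $\mu(2B)\le C\mu(B)$ for every ball $B$ ($2B$ is the concentric ball with twice the radius). Weighted amalgam spaces: for $1\le p\le\alpha\le s\le\infty$ and weights $\nu,w,\mu$, the space $(L^p,L^s)^{\alpha}(\nu,w;\mu)$ consists of all locally integrable $f$ with $$\|f\|_{(L^p,L^s)^{\alpha}(\nu,w;\mu)}:=\sup_{r>0}\Big\|w(B(y,r))^{1/\alpha-1/p-1/s}\,\|f\chi_{B(y,r)}\|_{L^p(\nu)}\Big\|_{L^s(\mu)}<\infty,$$ where the $L^s(\mu)$-norm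 (norm with respect to $\mu(y)\,dy$, usual modification when $s=\infty$) is taken in $y$, and $\|g\|_{L^p(\nu)}=(\int|g|^p\nu\,dx)^{1/p}$. The weak space $(WL^p,L^s)^{\alpha}(w;\mu)$ consists of all measurable $f$ with $$\|f\|_{(WL^p,L^s)^{\alpha}(w;\mu)}:=\sup_{r>0}\Big\|w(B(y,r))^{1/\alpha-1/p-1/s}\,\|f\chi_{B(y,r)}\|_{WL^p(w)}\Big\|_{L^s(\mu)}<\infty,$$ where $\|g\|_{WL^p(w)}=\sup_{\lambda>0}\lambda\,[w(\{x:|g(x)|>\lambda\})]^{1/p}$. *)

theory Defs
  imports "HOL-Analysis.Analysis" "HOL-Probability.Essential_Supremum"
begin

section \<open>Weights\<close>

definition locally_integrable ::
    "('a::euclidean_space \<Rightarrow> 'b::euclidean_space) \<Rightarrow> bool" where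
  "locally_integrable f \<longleftrightarrow> (\<forall>K. compact K \<longrightarrow> f absolutely_integrable_on K)"

definition weight :: "('a::euclidean_space \<Rightarrow> real) \<Rightarrow> bool" where
  "weight w \<longleftrightarrow> (\<forall>x. 0 \<le> w x) \<and> locally_integrable w"

text \<open>The measure \<open>w(x) dx\<close>, so that \<open>w(E)\<close> is \<open>emeasure (wmeasure w) E\<close>.\<close>

definition wmeasure :: "('a::euclidean_space \<Rightarrow> real) \<Rightarrow> 'a measure" where
  "wmeasure w = density lebesgue (\<lambda>x. ennreal (w x))"

text \<open>Real powers in \<open>[0,\<infinity>]\<close>, with \<open>x\<^sup>0 = 1\<close>, and \<open>0\<^sup>a = \<infinity>\<close>, \<open>\<infinity>\<^sup>a = 0\<close> for \<open>a < 0\<close>.\<close>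

definition epowr :: "ennreal \<Rightarrow> real \<Rightarrow> ennreal" where
  "epowr x a =
     (if a = 0 then 1
      else if x = 0 then (if a > 0 then 0 else \<infinity>)
      else if x = \<infinity> then (if a > 0 then \<infinity> else 0)
      else ennreal (enn2real x powr a))"

text \<open>The reciprocal of \<open>w\<close> is taken in \<open>[0,\<infinity>]\<close>, hence is \<open>\<infinity>\<close> where \<open>w\<close> vanishes.\<close>

definition A1_class :: "real \<Rightarrow> ('a::euclidean_space \<Rightarrow> real) set" where
  "A1_class q = {w. weight w \<and>
     (\<exists>C>0. \<forall>z. \<forall>r>0.
        epowr ((\<integral>\<^sup>+x\<in>ball z r. ennreal (w x powr q) \<partial>lebesgue) / emeasure lebesgue (ball z r)) (1 / q)
          * esssup (lebesgue_on (ball z r)) (\<lambda>x. inverse (ennreal (w x)))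
        \<le> ennreal C)}"

definition doubling_class :: "('a::euclidean_space \<Rightarrow> real) set" where
  "doubling_class = {\<mu>. weight \<mu> \<and>
     (\<exists>C>0. \<forall>z. \<forall>r>0.
        emeasure (wmeasure \<mu>) (ball z (2 * r)) \<le> ennreal C * emeasure (wmeasure \<mu>) (ball z r))}"


section \<open>Weighted amalgam spaces\<close>

text \<open>Norms take values in \<open>[0,\<infinity>]\<close>.  The exponent \<open>s\<close> may be \<open>\<infinity>\<close>, with \<open>1/\<infinity> = 0\<close>.\<close>

definition Lp_norm ::
    "('a::euclidean_space \<Rightarrow> real) \<Rightarrow> ennreal \<Rightarrow> ('a \<Rightarrow> ennreal) \<Rightarrow> ennreal" where
  "Lp_norm w p F =
     (if p = \<infinity> then esssup (wmeasure w) F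
      else epowr (\<integral>\<^sup>+x. epowr (F x) (enn2real p) \<partial>wmeasure w) (1 / enn2real p))"

definition weak_Lp_norm ::
    "('a::euclidean_space \<Rightarrow> real) \<Rightarrow> real \<Rightarrow> ('a \<Rightarrow> 'b::real_normed_vector) \<Rightarrow> ennreal" where
  "weak_Lp_norm w p g =
     (SUP l\<in>{0<..}. ennreal l * epowr (emeasure (wmeasure w) {x. norm (g x) > l}) (1 / p))"

definition amalgam_norm ::
    "real \<Rightarrow> ennreal \<Rightarrow> real \<Rightarrow> ('a::euclidean_space \<Rightarrow> real) \<Rightarrow> ('a \<Rightarrow> real) \<Rightarrow> ('a \<Rightarrow> real)
      \<Rightarrow> ('a \<Rightarrow> complex) \<Rightarrow> ennreal" where
  "amalgam_norm p s \<alpha> \<nu> w \<mu> f =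
     (SUP r\<in>{0<..}. Lp_norm \<mu> s (\<lambda>y.
        epowr (emeasure (wmeasure w) (ball y r)) (1 / \<alpha> - 1 / p - enn2real (1 / s))
        * Lp_norm \<nu> (ennreal p) (\<lambda>x. ennreal (norm (indicat_real (ball y r) x *\<^sub>R f x)))))"

definition amalgam_space ::
    "real \<Rightarrow> ennreal \<Rightarrow> real \<Rightarrow> ('a::euclidean_space \<Rightarrow> real) \<Rightarrow> ('a \<Rightarrow> real) \<Rightarrow> ('a \<Rightarrow> real)
      \<Rightarrow> ('a \<Rightarrow> complex) set" where
  "amalgam_space p s \<alpha> \<nu> w \<mu> =
     {f. locally_integrable f \<and> amalgam_norm p s \<alpha> \<nu> w \<mu> f < \<infinity>}"

definition weak_amalgam_norm ::
    "real \<Rightarrow> ennreal \<Rightarrow> real \<Rightarrow> ('a::euclidean_space \<Rightarrow> real) \<Rightarrow> ('a \<Rightarrow> real)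
      \<Rightarrow> ('a \<Rightarrow> complex) \<Rightarrow> ennreal" where
  "weak_amalgam_norm p s \<alpha> w \<mu> f =
     (SUP r\<in>{0<..}. Lp_norm \<mu> s (\<lambda>y.
        epowr (emeasure (wmeasure w) (ball y r)) (1 / \<alpha> - 1 / p - enn2real (1 / s))
        * weak_Lp_norm w p (\<lambda>x. indicat_real (ball y r) x *\<^sub>R f x)))"

definition weak_amalgam_space ::
    "real \<Rightarrow> ennreal \<Rightarrow> real \<Rightarrow> ('a::euclidean_space \<Rightarrow> real) \<Rightarrow> ('a \<Rightarrow> real)
      \<Rightarrow> ('a \<Rightarrow> complex) set" where
  "weak_amalgam_space p s \<alpha> w \<mu> =
     {f. f \<in> borel_measurable lebesgue \<and> weak_amalgam_norm p s \<alpha> w \<mu> f < \<infinity>}"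


section \<open>Operators and analytic semigroups on \<open>L\<^sup>2\<close>\<close>

text \<open>
  Elements of \<open>L\<^sup>2\<close> are represented by functions, and identities between them hold almost
  everywhere.  A bounded linear operator on representatives automatically respects almost
  everywhere equality.
\<close>

definition L2 :: "('a::euclidean_space \<Rightarrow> complex) set" where
  "L2 = {f \<in> borel_measurable lebesgue. integrable lebesgue (\<lambda>x. (norm (f x))\<^sup>2)}"

definition L2_norm :: "('a::euclidean_space \<Rightarrow> complex) \<Rightarrow> real" where
  "L2_norm f = sqrt (\<integral>x. (norm (f x))\<^sup>2 \<partial>lebesgue)"

definition L2_eq :: "('a::euclidean_space \<Rightarrow> complex) \<Rightarrow> ('a \<Rightarrow> complex) \<Rightarrow> bool" where
  "L2_eq f g \<longleftrightarrow> (AE x in lebesgue. f x = g x)"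

definition L2_linear_operator ::
    "('a::euclidean_space \<Rightarrow> complex) set \<Rightarrow> (('a \<Rightarrow> complex) \<Rightarrow> ('a \<Rightarrow> complex)) \<Rightarrow> bool" where
  "L2_linear_operator D L \<longleftrightarrow>
     D \<subseteq> L2 \<and> (\<lambda>x. 0) \<in> D \<and> L ` D \<subseteq> L2 \<and>
     (\<forall>f\<in>D. \<forall>g\<in>D. (\<lambda>x. f x + g x) \<in> D \<and> L2_eq (L (\<lambda>x. f x + g x)) (\<lambda>x. L f x + L g x)) \<and>
     (\<forall>f\<in>D. \<forall>c. (\<lambda>x. c * f x) \<in> D \<and> L2_eq (L (\<lambda>x. c * f x)) (\<lambda>x. c * L f x))"

definition L2_bounded_operator ::
    "(('a::euclidean_space \<Rightarrow> complex) \<Rightarrow> ('a \<Rightarrow> complex)) \<Rightarrow> bool" where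
  "L2_bounded_operator T \<longleftrightarrow>
     L2_linear_operator L2 T \<and> (\<exists>M. \<forall>f\<in>L2. L2_norm (T f) \<le> M * L2_norm f)"

definition C0_semigroup ::
    "(real \<Rightarrow> ('a::euclidean_space \<Rightarrow> complex) \<Rightarrow> ('a \<Rightarrow> complex)) \<Rightarrow> bool" where
  "C0_semigroup S \<longleftrightarrow>
     (\<forall>t\<ge>0. L2_bounded_operator (S t)) \<and>
     (\<forall>f\<in>L2. L2_eq (S 0 f) f) \<and>
     (\<forall>t\<ge>0. \<forall>u\<ge>0. \<forall>f\<in>L2. L2_eq (S (t + u) f) (S t (S u f))) \<and>
     (\<forall>f\<in>L2. ((\<lambda>t. L2_norm (\<lambda>x. S t f x - f x)) \<longlongrightarrow> 0) (at_right 0))"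

definition sector :: "real \<Rightarrow> complex set" where
  "sector \<theta> = {z. z \<noteq> 0 \<and> \<bar>Arg z\<bar> < \<theta>}"

text \<open>
  A strongly continuous semigroup is analytic if it extends to a semigroup on a sector which is
  (strongly) complex differentiable there and strongly continuous at \<open>0\<close> from every strictly
  smaller sector.
\<close>

definition analytic_semigroup ::
    "(real \<Rightarrow> ('a::euclidean_space \<Rightarrow> complex) \<Rightarrow> ('a \<Rightarrow> complex)) \<Rightarrow> bool" where
  "analytic_semigroup S \<longleftrightarrow> C0_semigroup S \<and>
     (\<exists>\<theta> T. 0 < \<theta> \<and> \<theta> \<le> pi / 2 \<and>
        (\<forall>t>0. \<forall>f\<in>L2. L2_eq (T (complex_of_real t) f) (S t f)) \<and>
        (\<forall>z\<in>sector \<theta>. L2_bounded_operator (T z)) \<and>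
        (\<forall>z\<in>sector \<theta>. \<forall>z'\<in>sector \<theta>. \<forall>f\<in>L2. L2_eq (T (z + z') f) (T z (T z' f))) \<and>
        (\<forall>z\<in>sector \<theta>. \<forall>f\<in>L2. \<exists>g\<in>L2.
           ((\<lambda>h. L2_norm (\<lambda>x. (T (z + h) f x - T z f x) / h - g x)) \<longlongrightarrow> 0) (at 0)) \<and>
        (\<forall>\<theta>'. 0 < \<theta>' \<and> \<theta>' < \<theta> \<longrightarrow>
           (\<forall>f\<in>L2. ((\<lambda>z. L2_norm (\<lambda>x. T z f x - f x)) \<longlongrightarrow> 0) (at 0 within sector \<theta>'))))"

text \<open>
  \<open>S t = e\<^bsup>-tL\<^esup>\<close>: the graph of \<open>L\<close>, with domain \<open>D\<close>, consists of all \<open>(f, g)\<close> for which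
  \<open>(f - S t f) / t\<close> tends to \<open>g\<close> in \<open>L\<^sup>2\<close> as \<open>t\<close> decreases to \<open>0\<close>; that is, \<open>-L\<close> is the
  infinitesimal generator of \<open>S\<close>.
\<close>

definition generates ::
    "('a::euclidean_space \<Rightarrow> complex) set \<Rightarrow> (('a \<Rightarrow> complex) \<Rightarrow> ('a \<Rightarrow> complex))
      \<Rightarrow> (real \<Rightarrow> ('a \<Rightarrow> complex) \<Rightarrow> ('a \<Rightarrow> complex)) \<Rightarrow> bool" where
  "generates D L S \<longleftrightarrow>
     (\<forall>f\<in>L2. \<forall>g\<in>L2. (f \<in> D \<and> L2_eq (L f) g) \<longleftrightarrow>
        ((\<lambda>t. L2_norm (\<lambda>x. (f x - S t f x) / complex_of_real t - g x)) \<longlongrightarrow> 0) (at_right 0))"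

text \<open>
  Joint measurability in \<open>(t, x, y)\<close> is what gives a meaning to the iterated integrals which
  define the fractional integral.
\<close>

definition semigroup_kernel ::
    "(real \<Rightarrow> ('a::euclidean_space \<Rightarrow> complex) \<Rightarrow> ('a \<Rightarrow> complex))
      \<Rightarrow> (real \<Rightarrow> 'a \<Rightarrow> 'a \<Rightarrow> complex) \<Rightarrow> bool" where
  "semigroup_kernel S p \<longleftrightarrow>
     (\<lambda>(t, x, y). p t x y) \<in> borel_measurable (lebesgue_on ({0<..} \<times> UNIV)) \<and>
     (\<forall>t>0. \<forall>f\<in>L2. AE x in lebesgue.
        integrable lebesgue (\<lambda>y. p t x y * f y) \<and> S t f x = (\<integral>y. p t x y * f y \<partial>lebesgue))"


section \<open>Generalized fractional integrals\<close>

definition semigroup_integral ::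
    "(real \<Rightarrow> 'a::euclidean_space \<Rightarrow> 'a \<Rightarrow> complex) \<Rightarrow> real \<Rightarrow> ('a \<Rightarrow> complex) \<Rightarrow> 'a \<Rightarrow> complex" where
  "semigroup_integral p t f x = (\<integral>y. p t x y * f y \<partial>lebesgue)"

definition frac_integral ::
    "(real \<Rightarrow> 'a::euclidean_space \<Rightarrow> 'a \<Rightarrow> complex) \<Rightarrow> real \<Rightarrow> ('a \<Rightarrow> complex) \<Rightarrow> 'a \<Rightarrow> complex" where
  "frac_integral p \<gamma> f x = complex_of_real (1 / Gamma (\<gamma> / 2)) *
     (LINT t:{0<..}|lebesgue. semigroup_integral p t f x * complex_of_real (t powr (\<gamma> / 2 - 1)))"

text \<open>
  The Bochner integral of a non-integrable function is \<open>0\<close>, so convergence of the integrals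
  defining \<open>frac_integral p \<gamma> f x\<close> is a separate property.
\<close>

definition frac_integral_converges ::
    "(real \<Rightarrow> 'a::euclidean_space \<Rightarrow> 'a \<Rightarrow> complex) \<Rightarrow> real \<Rightarrow> ('a \<Rightarrow> complex) \<Rightarrow> 'a \<Rightarrow> bool" where
  "frac_integral_converges p \<gamma> f x \<longleftrightarrow>
     (AE t in lebesgue. 0 < t \<longrightarrow> integrable lebesgue (\<lambda>y. p t x y * f y)) \<and>
     set_integrable lebesgue {0<..}
       (\<lambda>t. semigroup_integral p t f x * complex_of_real (t powr (\<gamma> / 2 - 1)))"

end

theory Submission
  imports Defs
begin

text \<open>
  For \<open>q > 1\<close> the weak type \<open>(1, q)\<close> bound of the Riesz potential reduces to its kernel: integrating
  \<open>|x - y|\<^bsup>\<gamma>-n\<^esup>\<close> over \<open>E\<close> against \<open>w\<^sup>q dx\<close> gives at most \<open>C w(y) w\<^sup>q(E)\<^bsup>1-1/q\<^esup>\<close>, because for almost every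
  \<open>y\<close> the class \<open>A(1,q)\<close> yields \<open>w\<^sup>q(B(y,r)) \<le> C r\<^sup>n w(y)\<^sup>q\<close> for all \<open>r\<close>.  The Gaussian bound dominates
  \<open>L\<^bsup>-\<gamma>/2\<^esup>\<close> by this potential.  On a ball \<open>B\<close>, the part of \<open>f\<close> inside \<open>2B\<close> is handled by the weak type
  bound; the part outside contributes a sum over dilates \<open>2\<^bsup>j+1\<^esup>B\<close> which converges geometrically,
  because \<open>w\<^sup>q\<close> satisfies \<open>w\<^sup>q(B) \<le> \<theta> w\<^sup>q(2B)\<close> with \<open>\<theta> < 1\<close> and \<open>1/\<beta> - 1/s > 0\<close>.  A geometric sum of
  functions bounded in \<open>L\<^sup>s(\<mu>)\<close> is bounded in \<open>L\<^sup>s(\<mu>)\<close>.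
\<close>

section \<open>Measures of balls and powers in the extended half-line\<close>

text \<open>The powers of w^q(B) in the two amalgam norms coincide: 1/\<alpha> - 1 - 1/s = 1/\<beta>
  - 1/q - 1/s, because 1/q = 1 - \<gamma>/n. So both sides can be compared pointwise in the centre,
  with concentric balls throughout, and the outer norm only meets a geometric series. The condition
  A(1,q) enters in a single form: if m is the essential infimum of w on a ball B of radius r, then
  w^q(B) is at most a multiple of r^n m^q. Testing m on subsets of B gives doubling and reverse
  doubling; a root of order q trades the kernel size r^(\<gamma>-n) for m w^q(B)^(-1/q). Two further
  obstacles shape the development. The semigroup kernel is measurable only for the completed product
  measure, so its sections behave well only for almost every parameter, and Borel representatives
  are required. Divergent Bochner integrals have a default value, so every size estimate runs
  through nonnegative integrals of absolute values, and convergence almost everywhere comes from the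
  same estimate, read at one suitable centre.\<close>

lemma sigma_finite_lebesgue: "sigma_finite_measure (lebesgue :: 'a::euclidean_space measure)"
proof
  obtain A :: "'a set set" where A: "countable A" "A \<subseteq> sets lborel" "\<Union>A = space lborel"
    "\<forall>a\<in>A. emeasure lborel a \<noteq> \<infinity>"
    using lborel.sigma_finite_countable by blast
  show "\<exists>A. countable A \<and> A \<subseteq> sets lebesgue \<and> \<Union>A = space lebesgue \<and>
      (\<forall>a\<in>A. emeasure (lebesgue :: 'a measure) a \<noteq> \<infinity>)"
    using A by (intro exI[of _ A]) auto
qed

interpretation lebesgue: sigma_finite_measure "lebesgue :: 'a::euclidean_space measure"
  by (rule sigma_finite_lebesgue)

interpretation lebesgue_pair: pair_sigma_finite
  "lebesgue :: 'a::euclidean_space measure" "lebesgue :: 'b::euclidean_space measure" ..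

lemma locally_integrable_measurable:
  fixes f :: "'a::euclidean_space \<Rightarrow> 'b::euclidean_space"
  assumes "locally_integrable f"
  shows "f \<in> borel_measurable lebesgue"
proof (rule borel_measurable_LIMSEQ_metric)
  fix k :: nat
  have "f absolutely_integrable_on cball 0 (real k)"
    using assms by (auto simp: locally_integrable_def)
  then show "(\<lambda>x. indicat_real (cball 0 (real k)) x *\<^sub>R f x) \<in> borel_measurable lebesgue"
    by (auto simp: set_integrable_def)
next
  fix x :: 'a
  obtain N :: nat where "norm x \<le> real N" using real_arch_simple by blast
  then have "eventually (\<lambda>k. indicat_real (cball 0 (real k)) x *\<^sub>R f x = f x) sequentially"
    by (intro eventually_sequentiallyI[of N]) (auto simp: indicator_def)
  then show "(\<lambda>k. indicat_real (cball 0 (real k)) x *\<^sub>R f x) \<longlonglongrightarrow> f x"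
    by (rule tendsto_eventually)
qed

lemma ball_in_sets_lebesgue [measurable]: "ball z r \<in> sets lebesgue"
  by simp

lemma sets_wmeasure [simp, measurable_cong]: "sets (wmeasure w) = sets lebesgue"
  by (simp add: wmeasure_def)

lemma space_wmeasure [simp]: "space (wmeasure w) = UNIV"
  by (simp add: wmeasure_def)

lemma emeasure_wmeasure:
  assumes "w \<in> borel_measurable lebesgue" "E \<in> sets lebesgue"
  shows "emeasure (wmeasure w) E = (\<integral>\<^sup>+x\<in>E. ennreal (w x) \<partial>lebesgue)"
  using assms unfolding wmeasure_def by (subst emeasure_density) auto

text \<open>Its contrapositive produces witnesses: unless \<open>\<mu>\<close> vanishes almost
  everywhere, a property that holds \<open>\<mu>\<close>-almost everywhere holds at some point. A
  centre with finite estimates is found this way.\<close>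

lemma AE_wmeasure_False:
  assumes "weight \<mu>" "AE x in wmeasure \<mu>. False"
  shows "AE x in lebesgue. \<mu> x = 0"
proof -
  have [measurable]: "\<mu> \<in> borel_measurable lebesgue" and nonneg: "\<And>x. 0 \<le> \<mu> x"
    using assms(1) locally_integrable_measurable by (auto simp: weight_def)
  have "AE x in lebesgue. \<not> 0 < ennreal (\<mu> x)"
    using assms(2) unfolding wmeasure_def by (subst (asm) AE_density) auto
  then show ?thesis
  proof eventually_elim
    case (elim x)
    then show ?case using nonneg[of x] by simp
  qed
qed

text \<open>Lower semicontinuity in the centre: an open ball is the increasing union of the
  concentric balls of radius r - 1/(k+1), and each of these stays inside \<open>ball z r\<close>
  when z moves by less than 1/(k+1). All measurability in the centre rests on this, for arbitrary
  measures on the Borel sets.\<close>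

lemma emeasure_ball_strict_greater_open:
  fixes M :: "'a::euclidean_space measure"
  assumes "sets borel \<subseteq> sets M"
  shows "open {y. c < emeasure M (ball y r)}"
proof (rule openI)
  fix y assume "y \<in> {y. c < emeasure M (ball y r)}"
  then have less: "c < emeasure M (ball y r)" by simp
  let ?B = "\<lambda>k::nat. ball y (r - 1 / Suc k)"
  have "(\<Union>k. ?B k) = ball y r"
  proof (intro equalityI subsetI)
    fix x assume "x \<in> ball y r"
    then have "0 < r - dist y x" by simp
    then obtain k :: nat where "inverse (Suc k) < r - dist y x"
      using reals_Archimedean by blast
    then show "x \<in> (\<Union>k. ?B k)" by (auto intro!: exI[of _ k] simp: inverse_eq_divide)
  next
    fix x assume "x \<in> (\<Union>k. ?B k)"
    then obtain k :: nat where "dist y x < r - 1 / Suc k" by auto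
    moreover have "0 < 1 / real (Suc k)" by simp
    ultimately show "x \<in> ball y r" by (simp only: mem_ball)
  qed
  moreover have "incseq ?B"
    by (intro incseq_SucI subset_ball) (simp add: field_simps)
  moreover have "range ?B \<subseteq> sets M" using assms by auto
  ultimately have "(SUP k. emeasure M (?B k)) = emeasure M (ball y r)"
    by (simp add: SUP_emeasure_incseq)
  with less have "c < (SUP k. emeasure M (?B k))" by simp
  then obtain k where k: "c < emeasure M (?B k)"
    unfolding less_SUP_iff by blast
  have "ball y (1 / Suc k) \<subseteq> {y. c < emeasure M (ball y r)}"
  proof
    fix z assume "z \<in> ball y (1 / Suc k)"
    then have "?B k \<subseteq> ball z r"
      by (auto simp: subset_iff) (smt (verit, best) dist_commute dist_triangle)
    then have "emeasure M (?B k) \<le> emeasure M (ball z r)"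
      using assms by (intro emeasure_mono) auto
    with k show "z \<in> {y. c < emeasure M (ball y r)}" by simp
  qed
  then show "\<exists>e>0. ball y e \<subseteq> {y. c < emeasure M (ball y r)}"
    by (intro exI[of _ "1 / Suc k"]) auto
qed

lemma borel_measurable_emeasure_ball:
  fixes M :: "'a::euclidean_space measure"
  assumes "sets borel \<subseteq> sets M"
  shows "(\<lambda>y. emeasure M (ball y r)) \<in> borel_measurable borel"
  using emeasure_ball_strict_greater_open[OF assms]
  by (intro borel_measurableI_greater) (auto intro: borel_open)

section \<open>Positive powers as order isomorphisms of the extended half-line\<close>

lemma epowr_mono: "0 \<le> a \<Longrightarrow> x \<le> y \<Longrightarrow> epowr x a \<le> epowr y a"
  by (cases x; cases y)
    (auto simp: epowr_def ennreal_le_iff powr_mono2 top_unique intro!: ennreal_leI powr_mono2)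

lemma epowr_ennreal: "0 < x \<Longrightarrow> epowr (ennreal x) a = ennreal (x powr a)"
  by (auto simp: epowr_def)

lemma epowr_ennreal_nonneg: "0 \<le> x \<Longrightarrow> 0 < a \<Longrightarrow> epowr (ennreal x) a = ennreal (x powr a)"
  by (auto simp: epowr_def)

lemma epowr_one [simp]: "epowr x 1 = x"
  by (cases x) (auto simp: epowr_def)

lemma epowr_zero_left [simp]: "0 < a \<Longrightarrow> epowr 0 a = 0"
  by (auto simp: epowr_def)

lemma epowr_top [simp]: "0 < a \<Longrightarrow> epowr \<infinity> a = \<infinity>" "0 < a \<Longrightarrow> epowr top a = top"
  by (auto simp: epowr_def)

lemma epowr_epowr:
  assumes "0 < a" "0 < b"
  shows "epowr (epowr x a) b = epowr x (a * b)"
  using assms by (cases x) (auto simp: epowr_def powr_powr ennreal_zero_less_top)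

lemma epowr_mult_ennreal:
  assumes "0 < c" "0 < a"
  shows "epowr (ennreal c * x) a = ennreal (c powr a) * epowr x a"
proof (cases x)
  case (real u)
  then show ?thesis
    using assms
    by (auto simp: epowr_ennreal_nonneg powr_mult simp flip: ennreal_mult)
next
  case top
  then show ?thesis using assms by (simp add: ennreal_mult_top)
qed

lemma borel_measurable_epowr [measurable]:
  assumes "f \<in> borel_measurable M"
  shows "(\<lambda>x. epowr (f x) a) \<in> borel_measurable M"
  using assms unfolding epowr_def by measurable

text \<open>A power with positive exponent is monotone with monotone inverse, the power 1/a, hence
  commutes with suprema.\<close>

lemma epowr_SUP:
  assumes "0 < a" "I \<noteq> {}"
  shows "epowr (SUP i\<in>I. f i) a = (SUP i\<in>I. epowr (f i) a)"
proof (rule antisym)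
  have "(SUP i\<in>I. f i) \<le> epowr (SUP i\<in>I. epowr (f i) a) (1 / a)"
  proof (rule SUP_least)
    fix i assume "i \<in> I"
    then have "epowr (f i) a \<le> (SUP i\<in>I. epowr (f i) a)" by (rule SUP_upper)
    then have "epowr (epowr (f i) a) (1 / a) \<le> epowr (SUP i\<in>I. epowr (f i) a) (1 / a)"
      using assms by (intro epowr_mono) auto
    then show "f i \<le> epowr (SUP i\<in>I. epowr (f i) a) (1 / a)"
      using assms by (simp add: epowr_epowr)
  qed
  then have "epowr (SUP i\<in>I. f i) a \<le> epowr (epowr (SUP i\<in>I. epowr (f i) a) (1 / a)) a"
    using assms by (intro epowr_mono) auto
  then show "epowr (SUP i\<in>I. f i) a \<le> (SUP i\<in>I. epowr (f i) a)"
    using assms by (simp add: epowr_epowr)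
next
  show "(SUP i\<in>I. epowr (f i) a) \<le> epowr (SUP i\<in>I. f i) a"
    using assms by (intro SUP_least epowr_mono) (auto intro: SUP_upper)
qed

section \<open>Weights of class A(1,q)\<close>

text \<open>The bound m is 1 / ess sup (1/w) on the ball, and \<open>K\<close> is the volume of the
  unit ball times the q-th power of the A(1,q) constant. A weight that is not almost everywhere zero
  is needed to make the essential supremum finite on every ball.\<close>

lemma A1_class_lower_bound:
  fixes w :: "'a::euclidean_space \<Rightarrow> real"
  assumes w: "w \<in> A1_class q" and q: "0 < q" and nz: "\<not> (AE x in lebesgue. w x = 0)"
  obtains K where "0 < K" "\<And>z r. 0 < r \<Longrightarrow> \<exists>m>0. (AE x in lebesgue. x \<in> ball z r \<longrightarrow> m \<le> w x) \<and>
     emeasure (wmeasure (\<lambda>x. w x powr q)) (ball z r) \<le> ennreal (K * r powr real DIM('a) * m powr q)"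
proof -
  let ?M = "wmeasure (\<lambda>x. w x powr q)"
  let ?v = "unit_ball_vol (real DIM('a))"
  obtain C where weight: "weight w" and C: "0 < C" "\<And>z r. 0 < r \<Longrightarrow>
        epowr ((\<integral>\<^sup>+x\<in>ball z r. ennreal (w x powr q) \<partial>lebesgue) / emeasure lebesgue (ball z r)) (1 / q)
          * esssup (lebesgue_on (ball z r)) (\<lambda>x. inverse (ennreal (w x))) \<le> ennreal C"
    using w unfolding A1_class_def by blast
  have [measurable]: "w \<in> borel_measurable lebesgue" and w0: "\<And>x. 0 \<le> w x"
    using weight locally_integrable_measurable by (auto simp: weight_def)
  have M: "emeasure ?M E = (\<integral>\<^sup>+x\<in>E. ennreal (w x powr q) \<partial>lebesgue)" if "E \<in> sets lebesgue" for E
    using that by (intro emeasure_wmeasure) auto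
  have v: "0 < ?v" by (rule unit_ball_vol_pos) simp
  have vol: "emeasure lebesgue (ball z r) = ennreal (?v * r powr real DIM('a))" if "0 < r" for z :: 'a and r
    using that by (simp add: emeasure_ball powr_realpow)
  have local: "\<exists>m>0. (AE x in lebesgue. x \<in> ball z r \<longrightarrow> m \<le> w x) \<and>
     emeasure ?M (ball z r) \<le> ennreal (?v * C powr q * r powr real DIM('a) * m powr q)"
    if r: "0 < r" and pos: "emeasure ?M (ball z r) \<noteq> 0" for z r
  proof -
    let ?S = "esssup (lebesgue_on (ball z r)) (\<lambda>x. inverse (ennreal (w x)))"
    let ?X = "emeasure ?M (ball z r) / emeasure lebesgue (ball z r)"
    have A: "epowr ?X (1 / q) * ?S \<le> ennreal C"
      using C(2)[OF r, of z] by (simp add: M)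
    \<comment> \<open>Since 0 * \<infinity> = 0, a vanishing average would be compatible with
      \<open>?S = \<infinity>\<close>; a nonzero average excludes that.\<close>
    have X: "?X \<noteq> 0" using pos by (simp add: vol[OF r] ennreal_divide_eq_0_iff)
    then have "epowr ?X (1 / q) \<noteq> 0" using q by (cases ?X) (auto simp: epowr_def)
    then have "?S \<noteq> \<infinity>" using A by (auto simp: ennreal_mult_top top_unique)
    have AE_S: "AE x in lebesgue. x \<in> ball z r \<longrightarrow> inverse (ennreal (w x)) \<le> ?S"
      using esssup_AE[of "\<lambda>x. inverse (ennreal (w x))" "lebesgue_on (ball z r)"]
      by (subst (asm) AE_restrict_space_iff) auto
    have "?S \<noteq> 0"
    proof
      assume "?S = 0"
      then have "AE x in lebesgue. x \<notin> ball z r"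
        using AE_S by (auto elim!: eventually_mono)
      then have "emeasure lebesgue (ball z r) = 0"
        by (subst (asm) AE_iff_measurable[where N = "ball z r"]) auto
      then show False using v r by (simp add: vol[OF r] del: emeasure_completion)
    qed
    then obtain \<sigma> where \<sigma>: "?S = ennreal \<sigma>" "0 < \<sigma>"
      using \<open>?S \<noteq> \<infinity>\<close> by (cases ?S) (auto simp: less_le)
    have "AE x in lebesgue. x \<in> ball z r \<longrightarrow> 1 / \<sigma> \<le> w x"
      using AE_S
    proof eventually_elim
      case (elim x)
      show ?case
      proof
        assume "x \<in> ball z r"
        then have le: "inverse (ennreal (w x)) \<le> ennreal \<sigma>" using elim \<sigma> by simp
        then have "w x \<noteq> 0" by (auto simp: top_unique)
        then have "0 < w x" using w0[of x] by simp
        then have "1 / w x \<le> \<sigma>" using le \<sigma> by (simp add: inverse_ennreal inverse_eq_divide)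
        then show "1 / \<sigma> \<le> w x" using \<open>0 < w x\<close> \<sigma> by (simp add: field_simps)
      qed
    qed
    moreover have "emeasure ?M (ball z r) \<le> ennreal (?v * C powr q * r powr real DIM('a) * (1 / \<sigma>) powr q)"
    proof -
      have "ennreal (1 / \<sigma>) * (epowr ?X (1 / q) * ennreal \<sigma>) \<le> ennreal (1 / \<sigma>) * ennreal C"
        using A \<sigma> by (intro mult_left_mono) auto
      also have "ennreal (1 / \<sigma>) * (epowr ?X (1 / q) * ennreal \<sigma>) = (ennreal (1 / \<sigma>) * ennreal \<sigma>) * epowr ?X (1 / q)"
        by (simp only: mult_ac)
      also have "ennreal (1 / \<sigma>) * ennreal \<sigma> = 1" using \<sigma> by (simp flip: ennreal_mult)
      finally have "epowr ?X (1 / q) \<le> ennreal (C * (1 / \<sigma>))"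
        using C(1) \<sigma> by (simp flip: ennreal_mult)
      then have "epowr (epowr ?X (1 / q)) q \<le> epowr (ennreal (C * (1 / \<sigma>))) q"
        using q by (intro epowr_mono) auto
      then have "?X \<le> ennreal ((C * (1 / \<sigma>)) powr q)"
        using q C(1) \<sigma> by (simp add: epowr_epowr epowr_ennreal)
      then have "?X * emeasure lebesgue (ball z r) \<le> ennreal ((C * (1 / \<sigma>)) powr q) * emeasure lebesgue (ball z r)"
        by (rule mult_right_mono) simp
      also have "?X * emeasure lebesgue (ball z r) = emeasure ?M (ball z r)"
      proof -
        have "ennreal (?v * r powr real DIM('a)) / ennreal (?v * r powr real DIM('a)) = 1"
          using v r by (intro ennreal_divide_self) (auto simp: ennreal_eq_0_iff not_le)
        then show ?thesis unfolding vol[OF r] by (simp only: ennreal_divide_times mult_1_right)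
      qed
      also have "ennreal ((C * (1 / \<sigma>)) powr q) * emeasure lebesgue (ball z r)
          = ennreal (?v * C powr q * r powr real DIM('a) * (1 / \<sigma>) powr q)"
        using v unfolding vol[OF r] powr_mult[of C "1 / \<sigma>"]
        by (subst ennreal_mult[symmetric]) (auto simp: mult_ac less_imp_le)
      finally show ?thesis .
    qed
    ultimately show ?thesis using \<sigma> by (intro exI[of _ "1 / \<sigma>"]) auto
  qed
  obtain k :: nat where k: "emeasure ?M (ball 0 (real k)) \<noteq> 0"
  proof (rule ccontr)
    assume "\<not> thesis"
    with that have zero: "emeasure ?M (ball 0 (real k)) = 0" for k by blast
    have "AE x in lebesgue. \<forall>k. w x * indicator (ball 0 (real k)) x = 0"
    proof (subst AE_all_countable, rule allI)
      fix k :: nat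
      have "(\<integral>\<^sup>+x\<in>ball 0 (real k). ennreal (w x powr q) \<partial>lebesgue) = 0"
        using zero[of k] by (simp add: M)
      then have "AE x in lebesgue. ennreal (w x powr q) * indicator (ball 0 (real k)) x = 0"
        by (subst (asm) nn_integral_0_iff_AE) measurable
      then show "AE x in lebesgue. w x * indicator (ball 0 (real k)) x = 0"
      proof eventually_elim
        case (elim x)
        then show ?case by (cases "x \<in> ball 0 (real k)") auto
      qed
    qed
    then have "AE x in lebesgue. w x = 0"
    proof eventually_elim
      case (elim x)
      obtain k :: nat where "norm x < real k" using reals_Archimedean2 by blast
      then show ?case using elim by (auto simp: indicator_def dest: spec[of _ k])
    qed
    with nz show False by simp
  qed
  have pos: "emeasure ?M (ball z r) \<noteq> 0" if r: "0 < r" for z r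
  proof -
    \<comment> \<open>A ball around 0 that contains both \<open>ball z r\<close> and a ball of
      positive measure: the essential lower bound m > 0 valid there passes to
      \<open>ball z r\<close>.\<close>
    define R where "R = max (real k) (norm z + r)"
    have R: "ball 0 (real k) \<subseteq> ball 0 R" "ball z r \<subseteq> ball 0 R" "0 < R"
    proof -
      show "ball 0 (real k) \<subseteq> ball 0 R" by (rule subset_ball) (simp add: R_def)
      show "0 < R" using r norm_ge_zero[of z] by (simp add: R_def less_max_iff_disj add_nonneg_pos)
      show "ball z r \<subseteq> ball 0 R"
      proof
        fix x assume "x \<in> ball z r"
        then have "norm x < norm z + r"
          using norm_triangle_ineq2[of x z] by (simp add: dist_norm norm_minus_commute)
        then show "x \<in> ball 0 R" by (simp add: R_def)
      qed
    qed
    have "emeasure ?M (ball 0 (real k)) \<le> emeasure ?M (ball 0 R)"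
      using R(1) by (rule emeasure_mono) simp
    then have "emeasure ?M (ball 0 R) \<noteq> 0" using k by auto
    then obtain m where m: "0 < m" "AE x in lebesgue. x \<in> ball 0 R \<longrightarrow> m \<le> w x"
      using local[OF R(3)] by blast
    show ?thesis
    proof
      assume "emeasure ?M (ball z r) = 0"
      then have "(\<integral>\<^sup>+x\<in>ball z r. ennreal (w x powr q) \<partial>lebesgue) = 0" by (simp add: M)
      then have "AE x in lebesgue. ennreal (w x powr q) * indicator (ball z r) x = 0"
        by (subst (asm) nn_integral_0_iff_AE) measurable
      with m(2) have "AE x in lebesgue. x \<notin> ball z r"
      proof eventually_elim
        case (elim x)
        then show ?case using R(2) m(1) by (cases "x \<in> ball z r") auto
      qed
      then have "emeasure lebesgue (ball z r) = 0"
        by (subst (asm) AE_iff_measurable[where N = "ball z r"]) auto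
      then show False using v r by (simp add: vol[OF r] del: emeasure_completion)
    qed
  qed
  show ?thesis
  proof (rule that)
    show "0 < ?v * C powr q" using v C(1) by simp
  qed (use local pos in blast)
qed

text \<open>
  For \<open>w\<close> not almost everywhere zero the condition \<open>A(1,q)\<close> takes the form \<open>lower_bound\<close>, where \<open>m\<close> is
  the essential infimum of \<open>w\<close> on the ball.
\<close>

locale A1q_weight =
  fixes w :: "'a::euclidean_space \<Rightarrow> real" and n \<gamma> q K :: real
  assumes n_eq: "n = real DIM('a)"
    and measurable_w [measurable]: "w \<in> borel_measurable lebesgue"
    and w_nonneg: "0 \<le> w x"
    and \<gamma>_pos: "0 < \<gamma>" and \<gamma>_less: "\<gamma> < n"
    and q_eq: "q = n / (n - \<gamma>)"
    and K_pos: "0 < K"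
    and lower_bound: "0 < r \<Longrightarrow> \<exists>m>0. (AE x in lebesgue. x \<in> ball z r \<longrightarrow> m \<le> w x) \<and>
       emeasure (wmeasure (\<lambda>x. w x powr q)) (ball z r) \<le> ennreal (K * r powr n * m powr q)"
begin

abbreviation "M \<equiv> wmeasure (\<lambda>x. w x powr q)"
abbreviation "V z r \<equiv> measure M (ball z r)"

lemma q_gt_1: "1 < q"
  using \<gamma>_pos \<gamma>_less by (simp add: q_eq)

lemma inverse_q: "1 / q = 1 - \<gamma> / n"
  using \<gamma>_pos \<gamma>_less by (simp add: q_eq field_simps)

lemma emeasure_M: "E \<in> sets lebesgue \<Longrightarrow> emeasure M E = (\<integral>\<^sup>+x\<in>E. ennreal (w x powr q) \<partial>lebesgue)"
  by (rule emeasure_wmeasure) auto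

section \<open>Comparison of w^q with Lebesgue measure on balls\<close>

lemma emeasure_M_lower:
  assumes "AE x in lebesgue. x \<in> ball z r \<longrightarrow> m \<le> w x" "0 < m" "E \<in> sets lebesgue" "E \<subseteq> ball z r"
  shows "ennreal (m powr q) * emeasure lebesgue E \<le> emeasure M E"
proof -
  have "ennreal (m powr q) * emeasure lebesgue E = (\<integral>\<^sup>+x\<in>E. ennreal (m powr q) \<partial>lebesgue)"
    using assms(3) by (simp add: nn_integral_cmult_indicator)
  also have "\<dots> \<le> (\<integral>\<^sup>+x\<in>E. ennreal (w x powr q) \<partial>lebesgue)"
    using assms(1)
  proof (intro nn_integral_mono_AE, eventually_elim)
    case (elim x)
    then show ?case
      using assms q_gt_1 by (auto simp: indicator_def intro!: ennreal_leI powr_mono2)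
  qed
  finally show ?thesis using assms(3) by (simp add: emeasure_M)
qed

text \<open>This is the A_1 type property of w^q, tested on subsets: w^q(B) is at most K r^n m^q,
  while m^q |E| is at most w^q(E). Taking E as a smaller ball gives doubling, taking E as an annulus
  gives reverse doubling.\<close>

lemma emeasure_M_compare:
  assumes "0 < r" "E \<in> sets lebesgue" "E \<subseteq> ball z r"
  shows "emeasure M (ball z r) * emeasure lebesgue E \<le> ennreal (K * r powr n) * emeasure M E"
proof -
  obtain m where m: "0 < m" "AE x in lebesgue. x \<in> ball z r \<longrightarrow> m \<le> w x"
    "emeasure M (ball z r) \<le> ennreal (K * r powr n * m powr q)"
    using lower_bound[OF \<open>0 < r\<close>] by blast
  have "emeasure M (ball z r) * emeasure lebesgue E
      \<le> ennreal (K * r powr n * m powr q) * emeasure lebesgue E"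
    using m(3) by (rule mult_right_mono) simp
  also have "\<dots> = ennreal (K * r powr n) * (ennreal (m powr q) * emeasure lebesgue E)"
    using K_pos by (simp add: ennreal_mult mult.assoc)
  also have "\<dots> \<le> ennreal (K * r powr n) * emeasure M E"
    using emeasure_M_lower[OF m(2,1) assms(2,3)] by (rule mult_left_mono) simp
  finally show ?thesis .
qed

lemma emeasure_M_ball_finite: "emeasure M (ball z r) < \<infinity>"
proof (cases "0 < r")
  case True
  then obtain m where "emeasure M (ball z r) \<le> ennreal (K * r powr n * m powr q)"
    using lower_bound by blast
  also have "\<dots> < \<infinity>" by simp
  finally show ?thesis .
next
  case False
  then have "ball z r = {}" by (simp add: ball_empty)
  then show ?thesis by (simp only: emeasure_empty) simp
qed

lemma emeasure_M_ball: "emeasure M (ball z r) = ennreal (V z r)"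
  using emeasure_M_ball_finite[of z r] by (intro emeasure_eq_ennreal_measure) auto

lemma emeasure_lborel_ball_powr:
  "0 \<le> r \<Longrightarrow> emeasure lborel (ball (z::'a) r) = ennreal (unit_ball_vol n * r powr n)"
  by (cases "r = 0") (auto simp: emeasure_ball powr_realpow n_eq)

lemma unit_ball_vol_n_pos: "0 < unit_ball_vol n"
  by (rule unit_ball_vol_pos) (simp add: n_eq)

lemma V_pos:
  assumes "0 < r" shows "0 < V z r"
proof -
  obtain m where m: "0 < m" "AE x in lebesgue. x \<in> ball z r \<longrightarrow> m \<le> w x"
    using lower_bound[OF \<open>0 < r\<close>] by blast
  have "0 < ennreal (m powr q) * emeasure lebesgue (ball z r)"
    using m assms unit_ball_vol_n_pos
    by (simp add: emeasure_lborel_ball_powr ennreal_zero_less_mult_iff)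
  also have "\<dots> \<le> emeasure M (ball z r)"
    by (rule emeasure_M_lower[OF m(2,1)]) auto
  finally show ?thesis by (simp add: emeasure_M_ball)
qed

lemma measure_M_compare:
  assumes "0 < r" "E \<in> sets lebesgue" "E \<subseteq> ball z r"
  shows "V z r * measure lebesgue E \<le> K * r powr n * measure M E"
proof -
  have "emeasure M E \<le> emeasure M (ball z r)" "emeasure lebesgue E \<le> emeasure lebesgue (ball z r)"
    by (rule emeasure_mono[OF assms(3)]; simp)+
  moreover have "emeasure lebesgue (ball z r) < \<infinity>"
    using emeasure_lborel_ball_finite[of z r] by simp
  ultimately have "emeasure M E < \<infinity>" "emeasure lebesgue E < \<infinity>"
    using emeasure_M_ball_finite[of z r] by (metis le_less_trans)+
  then have eq: "emeasure M E = ennreal (measure M E)"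
      "emeasure lebesgue E = ennreal (measure lebesgue E)"
    by (intro emeasure_eq_ennreal_measure; simp only: infinity_ennreal_def less_top)+
  show ?thesis
    using emeasure_M_compare[OF assms] K_pos unfolding emeasure_M_ball eq
    by (simp flip: ennreal_mult)
qed

lemma measure_lborel_ball_powr: "0 \<le> r \<Longrightarrow> measure lborel (ball (z::'a) r) = unit_ball_vol n * r powr n"
  using unit_ball_vol_n_pos by (simp add: measure_def emeasure_lborel_ball_powr)

lemma V_doubling:
  assumes "0 < r"
  shows "V z (2 * r) \<le> K * 2 powr n / unit_ball_vol n * V z r"
proof -
  have "V z (2 * r) * measure lebesgue (ball z r) \<le> K * (2 * r) powr n * V z r"
    using assms by (intro measure_M_compare) auto
  then have "(V z (2 * r) * unit_ball_vol n) * r powr n \<le> (K * 2 powr n * V z r) * r powr n"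
    using assms by (simp add: measure_lborel_ball_powr powr_mult mult_ac)
  then have "V z (2 * r) * unit_ball_vol n \<le> K * 2 powr n * V z r"
    by (rule mult_right_le_imp_le) (use assms in simp)
  then show ?thesis using unit_ball_vol_n_pos by (simp add: field_simps)
qed

text \<open>The comparison is applied to the annulus E = 2B - B, whose volume is v (2^n - 1) r^n
  with v the volume of the unit ball. It bounds w^q(2B) - w^q(B) below by a fixed fraction of
  w^q(2B); \<open>\<theta>\<close> is one minus that fraction. Positivity of \<open>\<theta>\<close>
  is read off from the inequality itself, as w^q(B) > 0.\<close>

lemma V_reverse_doubling:
  obtains \<theta> where "0 < \<theta>" "\<theta> < 1" "\<And>z r. 0 < r \<Longrightarrow> V z r \<le> \<theta> * V z (2 * r)"
proof -
  define \<theta> where "\<theta> = 1 - unit_ball_vol n * (2 powr n - 1) / (K * 2 powr n)"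
  have n1: "1 < (2::real) powr n" by (rule gr_one_powr) (auto simp: n_eq)
  have bound: "V z r \<le> \<theta> * V z (2 * r)" if "0 < r" for z r
  proof -
    let ?E = "ball z (2 * r) - ball z r"
    have sub: "ball z r \<subseteq> ball z (2 * r)" using that by (intro subset_ball) auto
    have "measure M ?E = V z (2 * r) - V z r"
      using sub emeasure_M_ball_finite[of z "2 * r"] by (intro measure_Diff) auto
    moreover have "measure lebesgue ?E = unit_ball_vol n * (2 powr n - 1) * r powr n"
    proof -
      have "measure lebesgue ?E = measure lebesgue (ball z (2 * r)) - measure lebesgue (ball z r)"
        using sub emeasure_lborel_ball_finite[of z "2 * r"] by (intro measure_Diff) auto
      then show ?thesis
        using that by (simp add: measure_lborel_ball_powr powr_mult algebra_simps)
    qed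
    moreover have "V z (2 * r) * measure lebesgue ?E \<le> K * (2 * r) powr n * measure M ?E"
      using that by (intro measure_M_compare) auto
    ultimately have "(V z (2 * r) * (unit_ball_vol n * (2 powr n - 1))) * r powr n
        \<le> (K * 2 powr n * (V z (2 * r) - V z r)) * r powr n"
      using that by (simp add: powr_mult mult_ac)
    then have "V z (2 * r) * (unit_ball_vol n * (2 powr n - 1)) \<le> K * 2 powr n * (V z (2 * r) - V z r)"
      by (rule mult_right_le_imp_le) (use that in simp)
    then have "V z (2 * r) * (unit_ball_vol n * (2 powr n - 1)) / (K * 2 powr n) \<le> V z (2 * r) - V z r"
      using K_pos by (subst pos_divide_le_eq) (auto simp: mult_ac)
    then show ?thesis by (simp add: \<theta>_def algebra_simps)
  qed
  have "0 < \<theta> * V 0 (2 * 1)"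
    using bound[of 1 0] V_pos[of 1 0] by simp
  then have "0 < \<theta>" using V_pos[of "2 * 1" 0] by (simp add: zero_less_mult_iff)
  moreover have "\<theta> < 1"
    using unit_ball_vol_n_pos K_pos n1 by (simp add: \<theta>_def)
  ultimately show ?thesis using that bound by blast
qed

text \<open>The root of order q of w^q(B) \<le> K r^n m^q contains r^(n/q) = r^(n-\<gamma>), the
  reciprocal of the kernel size at distance r. Solving for r^(\<gamma>-n) leaves a factor m, and m
  \<le> w almost everywhere on the ball puts the weight under the integral.\<close>

lemma integral_ball_le_weighted:
  fixes g :: "'a \<Rightarrow> ennreal"
  assumes [measurable]: "g \<in> borel_measurable lebesgue" and "0 < r"
  shows "ennreal (r powr (\<gamma> - n)) * (\<integral>\<^sup>+x\<in>ball z r. g x \<partial>lebesgue)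
    \<le> ennreal (K powr (1 / q) * V z r powr (- (1 / q))) * (\<integral>\<^sup>+x\<in>ball z r. g x * ennreal (w x) \<partial>lebesgue)"
proof -
  obtain m where m: "0 < m" "AE x in lebesgue. x \<in> ball z r \<longrightarrow> m \<le> w x"
    "emeasure M (ball z r) \<le> ennreal (K * r powr n * m powr q)"
    using lower_bound[OF \<open>0 < r\<close>] by blast
  have "V z r \<le> K * r powr n * m powr q"
    using m(3) K_pos by (simp add: emeasure_M_ball)
  then have "V z r powr (1 / q) \<le> (K * r powr n * m powr q) powr (1 / q)"
    using q_gt_1 by (intro powr_mono2) auto
  also have "\<dots> = K powr (1 / q) * r powr (n - \<gamma>) * m"
  proof -
    have "n / q = n - \<gamma>" using \<gamma>_pos \<gamma>_less by (simp add: q_eq)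
    then show ?thesis
      using K_pos m(1) q_gt_1 by (simp add: powr_mult powr_powr)
  qed
  finally have V: "V z r powr (1 / q) \<le> K powr (1 / q) * r powr (n - \<gamma>) * m" .
  have "1 / R \<le> a * (1 / v) * m" if "v \<le> a * R * m" "0 < v" "0 < R" for a R v :: real
    using that by (simp add: field_simps)
  from this[OF V] have "r powr (\<gamma> - n) \<le> K powr (1 / q) * V z r powr (- (1 / q)) * m"
    using V_pos[OF \<open>0 < r\<close>, of z] \<open>0 < r\<close> powr_minus_divide[of r "n - \<gamma>"]
    by (simp add: powr_minus_divide)
  then have "ennreal (r powr (\<gamma> - n)) * (\<integral>\<^sup>+x\<in>ball z r. g x \<partial>lebesgue)
      \<le> ennreal (K powr (1 / q) * V z r powr (- (1 / q)) * m) * (\<integral>\<^sup>+x\<in>ball z r. g x \<partial>lebesgue)"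
    by (intro mult_right_mono ennreal_leI) auto
  also have "\<dots> = ennreal (K powr (1 / q) * V z r powr (- (1 / q)))
      * (\<integral>\<^sup>+x\<in>ball z r. g x * ennreal m \<partial>lebesgue)"
  proof -
    have "(\<integral>\<^sup>+x\<in>ball z r. g x * ennreal m \<partial>lebesgue) = ennreal m * (\<integral>\<^sup>+x\<in>ball z r. g x \<partial>lebesgue)"
      by (subst nn_integral_cmult[symmetric]) (measurable, auto intro!: nn_integral_cong simp: mult_ac)
    then show ?thesis using m(1) by (simp add: ennreal_mult mult.assoc)
  qed
  also have "\<dots> \<le> ennreal (K powr (1 / q) * V z r powr (- (1 / q)))
      * (\<integral>\<^sup>+x\<in>ball z r. g x * ennreal (w x) \<partial>lebesgue)"
  proof (rule mult_left_mono)
    show "(\<integral>\<^sup>+x\<in>ball z r. g x * ennreal m \<partial>lebesgue) \<le> (\<integral>\<^sup>+x\<in>ball z r. g x * ennreal (w x) \<partial>lebesgue)"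
      using m(2)
    proof (intro nn_integral_mono_AE, eventually_elim)
      case (elim x)
      then show ?case by (auto simp: indicator_def intro!: mult_left_mono ennreal_leI)
    qed
  qed simp
  finally show ?thesis .
qed

text \<open>The exceptional null set has to serve all radii at once. Therefore the lower bounds are
  collected only for balls with centre in a countable dense set and rational radius, and an
  arbitrary ball around y is placed inside one of these of less than twice the radius; this is the
  origin of 2^n.\<close>

lemma AE_V_le:
  "AE y in lebesgue. 0 < w y \<and> (\<forall>r>0. V y r \<le> K * 2 powr n * r powr n * w y powr q)"
proof -
  obtain Q :: "'a set" where Q: "countable Q" "\<And>X. open X \<Longrightarrow> X \<noteq> {} \<Longrightarrow> \<exists>d\<in>Q. d \<in> X"
    using countable_dense_setE by blast
  define m where "m z r = (SOME m. 0 < m \<and> (AE x in lebesgue. x \<in> ball z r \<longrightarrow> m \<le> w x) \<and>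
       emeasure M (ball z r) \<le> ennreal (K * r powr n * m powr q))" for z r
  have "0 < m z r \<and> (AE x in lebesgue. x \<in> ball z r \<longrightarrow> m z r \<le> w x) \<and>
       emeasure M (ball z r) \<le> ennreal (K * r powr n * m z r powr q)" if "0 < r" for z r
    unfolding m_def by (rule someI_ex[OF lower_bound[OF that]])
  then have m: "\<And>z r. 0 < r \<Longrightarrow> m z r > 0"
     "\<And>z r. 0 < r \<Longrightarrow> AE x in lebesgue. x \<in> ball z r \<longrightarrow> m z r \<le> w x"
     "\<And>z r. 0 < r \<Longrightarrow> emeasure M (ball z r) \<le> ennreal (K * r powr n * m z r powr q)"
    by blast+
  have "AE y in lebesgue. \<forall>d\<in>Q. \<forall>\<rho>\<in>\<rat>. 0 < \<rho> \<longrightarrow> y \<in> ball d \<rho> \<longrightarrow> m d \<rho> \<le> w y"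
    unfolding AE_ball_countable[OF Q(1)] AE_ball_countable[OF countable_rat]
  proof (intro ballI)
    fix d and \<rho> :: real
    show "AE y in lebesgue. 0 < \<rho> \<longrightarrow> y \<in> ball d \<rho> \<longrightarrow> m d \<rho> \<le> w y"
      by (cases "0 < \<rho>") (use m(2)[of \<rho> d] in simp_all)
  qed
  then show ?thesis
  proof eventually_elim
    case (elim y)
    have key: "0 < w y \<and> V y r \<le> K * 2 powr n * r powr n * w y powr q" if "0 < r" for r
    proof -
      have "ball y (r / 4) \<noteq> {}" using that by simp
      then obtain d where d: "d \<in> Q" "dist y d < r / 4"
        using Q(2)[of "ball y (r / 4)"] unfolding mem_ball by blast
      \<comment> \<open>As d is closer than r/4 to y, every radius above 5r/4 makes the ball around
        d cover \<open>ball y r\<close>.\<close>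
      have "5 * r / 4 < 2 * r" using that by simp
      then obtain \<rho> where \<rho>: "\<rho> \<in> \<rat>" "5 * r / 4 < \<rho>" "\<rho> < 2 * r"
        using Rats_dense_in_real by blast
      have "0 < \<rho>" using \<rho> that by simp
      have "y \<in> ball d \<rho>" using d \<rho> that by (simp add: dist_commute)
      then have mw: "m d \<rho> \<le> w y" using elim d(1) \<rho>(1) \<open>0 < \<rho>\<close> by blast
      have "ball y r \<subseteq> ball d \<rho>"
        using d(2) \<rho>(2) by (auto simp: subset_iff) (smt (verit, best) dist_commute dist_triangle)
      then have "emeasure M (ball y r) \<le> emeasure M (ball d \<rho>)" by (intro emeasure_mono) auto
      also have "\<dots> \<le> ennreal (K * \<rho> powr n * m d \<rho> powr q)" by (rule m(3)[OF \<open>0 < \<rho>\<close>])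
      also have "\<dots> \<le> ennreal (K * (2 * r) powr n * w y powr q)"
        using K_pos \<rho> \<open>0 < \<rho>\<close> mw m(1)[OF \<open>0 < \<rho>\<close>, of d] q_gt_1 \<gamma>_pos \<gamma>_less
        by (intro ennreal_leI mult_mono powr_mono2) auto
      finally show ?thesis
        using mw m(1)[OF \<open>0 < \<rho>\<close>, of d] K_pos that
        by (simp add: emeasure_M_ball powr_mult mult_ac)
    qed
    then show ?case using key[of 1] by auto
  qed
qed

end

section \<open>The weak type estimate for the Riesz potential\<close>

lemma ennreal_le_suminf: "(f :: nat \<Rightarrow> ennreal) k \<le> (\<Sum>i. f i)"
  by (rule order_trans[OF _ sum_le_suminf[of f "{k}"]]) auto

lemma suminf_geometric_ennreal:
  assumes "0 \<le> c" "0 \<le> \<rho>" "\<rho> < 1"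
  shows "(\<Sum>k. ennreal (c * \<rho> ^ k)) = ennreal (c * (1 / (1 - \<rho>)))"
  using assms by (intro suminf_ennreal_eq sums_mult geometric_sums) auto

lemma suminf_geometric_mult:
  assumes "0 < \<rho>" "\<rho> < 1"
  shows "(\<Sum>j. ennreal (\<rho> ^ j) * N) = ennreal (1 / (1 - \<rho>)) * N"
proof -
  have "(\<Sum>j. ennreal (\<rho> ^ j)) = ennreal (1 / (1 - \<rho>))"
    using assms by (intro suminf_ennreal_eq geometric_sums) auto
  then show ?thesis by (simp only: ennreal_suminf_multc)
qed

lemma two_powr_minus_nat: "2 powr (- real k) = (1 / 2) ^ k"
  by (simp add: powr_minus powr_realpow power_one_over inverse_eq_divide)

lemma dyadic_shell_inside:
  fixes d R :: real
  assumes "0 < d" "d < R"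
  obtains k :: nat where "R * 2 powr (- real (Suc k)) \<le> d" "d < R * 2 powr (- real k)"
proof -
  let ?P = "\<lambda>k. R * (1 / 2) ^ k \<le> d"
  have "\<exists>k. (1 / 2) ^ k < d / R"
    using assms by (intro real_arch_pow_inv) auto
  then have ex: "\<exists>k. ?P k"
    using assms by (auto simp: field_simps intro: less_imp_le)
  have "\<not> ?P 0" using assms by simp
  then obtain k where k: "(LEAST k. ?P k) = Suc k"
    using LeastI_ex[OF ex] by (metis not0_implies_Suc)
  have "?P (Suc k)" using LeastI_ex[OF ex] k by simp
  moreover have "\<not> ?P k" using not_less_Least[of k ?P] k by simp
  ultimately show ?thesis
    using that[of k] unfolding two_powr_minus_nat by simp
qed

lemma dyadic_shell_outside:
  fixes d R :: real
  assumes "0 < R" "R \<le> d"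
  obtains k :: nat where "2 ^ k * R \<le> d" "d < 2 ^ Suc k * R"
proof -
  let ?P = "\<lambda>k. d < 2 ^ k * R"
  have "\<exists>k. d / R < 2 ^ k" by (rule real_arch_pow) simp
  then have ex: "\<exists>k. ?P k" using assms by (auto simp: field_simps)
  have "\<not> ?P 0" using assms by simp
  then obtain k where k: "(LEAST k. ?P k) = Suc k"
    using LeastI_ex[OF ex] by (metis not0_implies_Suc)
  have "?P (Suc k)" using LeastI_ex[OF ex] k by simp
  moreover have "\<not> ?P k" using not_less_Least[of k ?P] k by simp
  ultimately show ?thesis using that[of k] by simp
qed

text \<open>On the diagonal the kernel has the junk value \<open>0 powr a = 0\<close>, which only affects a null set.\<close>

definition riesz_potential :: "real \<Rightarrow> ('a::euclidean_space \<Rightarrow> ennreal) \<Rightarrow> 'a \<Rightarrow> ennreal" where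
  "riesz_potential a g x = (\<integral>\<^sup>+y. ennreal (norm (x - y) powr a) * g y \<partial>lebesgue)"

text \<open>Lets the kernel, a Borel function of x - y, be recognised as measurable on products of
  completed measures.\<close>

lemma measurable_lebesgue_ident [measurable]: "(\<lambda>x. x) \<in> (lebesgue :: 'a::euclidean_space measure) \<rightarrow>\<^sub>M borel"
  by (rule measurable_completion) simp

lemma borel_measurable_riesz_potential [measurable]:
  fixes g :: "'a::euclidean_space \<Rightarrow> ennreal"
  assumes [measurable]: "g \<in> borel_measurable lebesgue"
  shows "riesz_potential a g \<in> borel_measurable lebesgue"
  unfolding riesz_potential_def by measurable

context A1q_weight
begin

text \<open>The summand 1 pays for the part of the kernel outside the splitting radius, the other
  one for the shells inside: K 2^n is the growth constant of w^q(B(y,r)), the factor 2^(n-\<gamma>)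
  comes from evaluating the kernel at the inner radius of a shell, and the shells decay with ratio
  2^(-\<gamma>).\<close>

definition "Cp = 1 + K * 2 powr n * 2 powr (n - \<gamma>) * (1 / (1 - 2 powr (- \<gamma>)))"

lemma Cp_pos: "0 < Cp"
proof -
  have "2 powr (- \<gamma>) < 1" using \<gamma>_pos powr_less_mono[of "- \<gamma>" 0 2] by simp
  then show ?thesis using K_pos by (simp add: Cp_def add_pos_nonneg)
qed

text \<open>Splitting the kernel at the radius \<open>R\<close> with \<open>R\<^sup>n w(y)\<^sup>q = w\<^sup>q(E)\<close> makes both parts comparable.\<close>

lemma kernel_integral_le:
  assumes y: "0 < w y" "\<And>r. 0 < r \<Longrightarrow> V y r \<le> K * 2 powr n * r powr n * w y powr q"
    and E [measurable]: "E \<in> sets lebesgue" and fin: "emeasure M E < \<infinity>"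
  shows "(\<integral>\<^sup>+x\<in>E. ennreal (norm (x - y) powr (\<gamma> - n)) \<partial>M)
    \<le> ennreal (Cp * w y * measure M E powr (1 - 1 / q))"
proof (cases "measure M E = 0")
  case True
  then have "E \<in> null_sets M"
    using fin by (auto simp: null_sets_def emeasure_eq_ennreal_measure)
  then have "(\<integral>\<^sup>+x\<in>E. ennreal (norm (x - y) powr (\<gamma> - n)) \<partial>M) = 0"
    by (simp add: nn_integral_null_set)
  then show ?thesis by simp
next
  case False
  define e where "e = measure M E"
  define b where "b = w y powr q"
  define R where "R = (e / b) powr (1 / n)"
  define \<rho> where "\<rho> = 2 powr (- \<gamma>)"
  have e: "0 < e" using False by (simp add: e_def zero_less_measure_iff)
  have b: "0 < b" using y(1) by (simp add: b_def)
  have n: "0 < n" using \<gamma>_pos \<gamma>_less by simp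
  have R: "0 < R" using e b by (simp add: R_def)
  have eM: "emeasure M E = ennreal e"
    unfolding e_def using fin by (intro emeasure_eq_ennreal_measure) auto
  have \<rho>: "0 < \<rho>" "\<rho> < 1" using \<gamma>_pos powr_less_mono[of "- \<gamma>" 0 2] by (auto simp: \<rho>_def)
  let ?s = "\<lambda>k. R * 2 powr (- real k)"
  let ?c = "\<lambda>k. ?s (Suc k) powr (\<gamma> - n)"
  \<comment> \<open>The diagonal x = y, where the kernel has the value 0, is counted with the far
    part.\<close>
  have pointwise: "ennreal (norm (x - y) powr (\<gamma> - n)) * indicator E x
      \<le> ennreal (R powr (\<gamma> - n)) * indicator E x + (\<Sum>k. ennreal (?c k) * indicator (ball y (?s k)) x)" for x
  proof (cases "x = y \<or> R \<le> norm (x - y)")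
    case True
    then have "norm (x - y) powr (\<gamma> - n) \<le> R powr (\<gamma> - n)"
      using R \<gamma>_less by (auto intro: powr_mono2')
    then show ?thesis
      by (intro add_increasing2 mult_right_mono ennreal_leI) auto
  next
    case False
    then obtain k where k: "?s (Suc k) \<le> norm (x - y)" "norm (x - y) < ?s k"
      using dyadic_shell_inside[of "norm (x - y)" R] by auto
    have "ennreal (norm (x - y) powr (\<gamma> - n)) * indicator E x \<le> ennreal (?c k) * indicator (ball y (?s k)) x"
      using k R \<gamma>_less
      by (auto simp: indicator_def dist_norm norm_minus_commute intro!: ennreal_leI powr_mono2')
    also have "\<dots> \<le> (\<Sum>k. ennreal (?c k) * indicator (ball y (?s k)) x)"
      by (rule ennreal_le_suminf)
    finally show ?thesis by (intro add_increasing) auto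
  qed
  have "(\<integral>\<^sup>+x\<in>E. ennreal (norm (x - y) powr (\<gamma> - n)) \<partial>M)
      \<le> (\<integral>\<^sup>+x. (ennreal (R powr (\<gamma> - n)) * indicator E x
          + (\<Sum>k. ennreal (?c k) * indicator (ball y (?s k)) x)) \<partial>M)"
    by (rule nn_integral_mono) (rule pointwise)
  also have "\<dots> = ennreal (R powr (\<gamma> - n)) * emeasure M E + (\<Sum>k. ennreal (?c k) * emeasure M (ball y (?s k)))"
    by (simp add: nn_integral_add nn_integral_suminf nn_integral_cmult_indicator)
  also have "\<dots> \<le> ennreal (R powr (\<gamma> - n) * e)
      + (\<Sum>k. ennreal (K * 2 powr n * 2 powr (n - \<gamma>) * b * R powr \<gamma> * \<rho> ^ k))"
  proof (intro add_mono suminf_le)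
    show "ennreal (R powr (\<gamma> - n)) * emeasure M E \<le> ennreal (R powr (\<gamma> - n) * e)"
      using e by (simp add: eM ennreal_mult)
    fix k :: nat
    have "?c k * V y (?s k) \<le> ?c k * (K * 2 powr n * ?s k powr n * b)"
      using y(2)[of "?s k"] R by (intro mult_left_mono) (auto simp: b_def)
    also have "\<dots> = K * 2 powr n * 2 powr (n - \<gamma>) * b * R powr \<gamma> * \<rho> ^ k"
    proof -
      have "?c k * ?s k powr n = (R powr (\<gamma> - n) * R powr n)
          * (2 powr (- real (Suc k) * (\<gamma> - n)) * 2 powr (- real k * n))"
        by (simp add: powr_mult powr_powr)
      also have "R powr (\<gamma> - n) * R powr n = R powr \<gamma>"
        by (simp flip: powr_add)
      also have "2 powr (- real (Suc k) * (\<gamma> - n)) * 2 powr (- real k * n) = 2 powr (n - \<gamma>) * \<rho> ^ k"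
        by (simp add: \<rho>_def powr_power flip: powr_add) (simp add: algebra_simps)
      finally show ?thesis by (simp add: mult_ac)
    qed
    finally show "ennreal (?c k) * emeasure M (ball y (?s k))
        \<le> ennreal (K * 2 powr n * 2 powr (n - \<gamma>) * b * R powr \<gamma> * \<rho> ^ k)"
      by (simp add: emeasure_M_ball ennreal_leI flip: ennreal_mult)
  qed auto
  also have "\<dots> = ennreal (R powr (\<gamma> - n) * e
      + K * 2 powr n * 2 powr (n - \<gamma>) * b * R powr \<gamma> * (1 / (1 - \<rho>)))"
    using \<rho> K_pos b e by (subst suminf_geometric_ennreal) (auto simp: ennreal_plus)
  also have "R powr (\<gamma> - n) * e + K * 2 powr n * 2 powr (n - \<gamma>) * b * R powr \<gamma> * (1 / (1 - \<rho>))
      = Cp * (b * R powr \<gamma>)"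
  proof -
    have "R powr n = e / b" using e b n by (simp add: R_def powr_powr)
    then have "R powr (\<gamma> - n) * e = b * R powr \<gamma>"
      using e b by (simp add: powr_diff)
    then show ?thesis by (simp add: Cp_def \<rho>_def algebra_simps)
  qed
  \<comment> \<open>With R = (e/b)^(1/n) the product is b^(1-\<gamma>/n) e^(\<gamma>/n), and 1 -
    \<gamma>/n = 1/q turns b = w(y)^q into w(y).\<close>
  also have "b * R powr \<gamma> = w y * e powr (1 - 1 / q)"
  proof -
    have "b * R powr \<gamma> = (b / b powr (\<gamma> / n)) * e powr (\<gamma> / n)"
      using e b by (simp add: R_def powr_powr powr_divide)
    also have "b / b powr (\<gamma> / n) = b powr (1 / q)"
      using b by (simp add: inverse_q powr_diff)
    also have "b powr (1 / q) = w y"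
      using y(1) q_gt_1 by (simp add: b_def powr_powr)
    also have "\<gamma> / n = 1 - 1 / q" by (simp add: inverse_q)
    finally show ?thesis .
  qed
  finally show ?thesis by (simp add: e_def mult.assoc)
qed

text \<open>Chebyshev on E and Tonelli: l w^q(E) is at most the integral of g(y) times the kernel
  integrated over E, and the latter is at most Cp w(y) w^q(E)^(1-1/q). Dividing by this power of
  w^q(E), which is finite and nonzero, leaves the exponent 1/q. E may be any part of the superlevel
  set, so that it can be cut down to a ball of finite measure.\<close>

lemma weak_type_estimate:
  assumes [measurable]: "g \<in> borel_measurable lebesgue" "E \<in> sets lebesgue"
    and fin: "emeasure M E < \<infinity>" and l: "0 \<le> l"
    and le: "\<And>x. x \<in> E \<Longrightarrow> ennreal l \<le> riesz_potential (\<gamma> - n) g x"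
  shows "ennreal (l * measure M E powr (1 / q)) \<le> ennreal Cp * (\<integral>\<^sup>+y. g y * ennreal (w y) \<partial>lebesgue)"
proof (cases "measure M E = 0")
  case True
  then show ?thesis by simp
next
  case False
  define e where "e = measure M E"
  have e: "0 < e" using False by (simp add: e_def zero_less_measure_iff)
  have eM: "emeasure M E = ennreal e"
    unfolding e_def using fin by (intro emeasure_eq_ennreal_measure) auto
  let ?k = "\<lambda>x y. ennreal (norm (x - y) powr (\<gamma> - n))"
  let ?J = "\<integral>\<^sup>+y. g y * ennreal (w y) \<partial>lebesgue"
  have "ennreal (l * e) = (\<integral>\<^sup>+x\<in>E. ennreal l \<partial>M)"
    using l e by (simp add: nn_integral_cmult_indicator eM ennreal_mult)
  also have "\<dots> \<le> (\<integral>\<^sup>+x\<in>E. riesz_potential (\<gamma> - n) g x \<partial>M)"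
    by (intro nn_integral_mono) (auto simp: indicator_def le)
  also have "\<dots> = (\<integral>\<^sup>+x. ennreal (w x powr q) * (riesz_potential (\<gamma> - n) g x * indicator E x) \<partial>lebesgue)"
    unfolding wmeasure_def by (subst nn_integral_density) auto
  also have "\<dots> = (\<integral>\<^sup>+x. \<integral>\<^sup>+y. ennreal (w x powr q) * indicator E x * ?k x y * g y \<partial>lebesgue \<partial>lebesgue)"
  proof (intro nn_integral_cong)
    fix x
    have "(\<integral>\<^sup>+y. (ennreal (w x powr q) * indicator E x) * (?k x y * g y) \<partial>lebesgue)
        = (ennreal (w x powr q) * indicator E x) * riesz_potential (\<gamma> - n) g x"
      unfolding riesz_potential_def by (rule nn_integral_cmult) measurable
    then show "ennreal (w x powr q) * (riesz_potential (\<gamma> - n) g x * indicator E x)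
        = (\<integral>\<^sup>+y. ennreal (w x powr q) * indicator E x * ?k x y * g y \<partial>lebesgue)"
      by (simp add: mult_ac)
  qed
  also have "\<dots> = (\<integral>\<^sup>+y. \<integral>\<^sup>+x. ennreal (w x powr q) * indicator E x * ?k x y * g y \<partial>lebesgue \<partial>lebesgue)"
    by (rule lebesgue_pair.Fubini'[symmetric]) measurable
  also have "\<dots> = (\<integral>\<^sup>+y. g y * (\<integral>\<^sup>+x\<in>E. ?k x y \<partial>M) \<partial>lebesgue)"
  proof (intro nn_integral_cong)
    fix y
    have "(\<integral>\<^sup>+x\<in>E. ?k x y \<partial>M) = (\<integral>\<^sup>+x. ennreal (w x powr q) * (?k x y * indicator E x) \<partial>lebesgue)"
      unfolding wmeasure_def by (subst nn_integral_density) auto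
    moreover have "(\<integral>\<^sup>+x. g y * (ennreal (w x powr q) * (?k x y * indicator E x)) \<partial>lebesgue)
       = g y * (\<integral>\<^sup>+x. ennreal (w x powr q) * (?k x y * indicator E x) \<partial>lebesgue)"
      by (rule nn_integral_cmult) measurable
    ultimately show "(\<integral>\<^sup>+x. ennreal (w x powr q) * indicator E x * ?k x y * g y \<partial>lebesgue)
        = g y * (\<integral>\<^sup>+x\<in>E. ?k x y \<partial>M)"
      by (simp add: mult_ac)
  qed
  also have "\<dots> \<le> (\<integral>\<^sup>+y. ennreal (Cp * e powr (1 - 1 / q)) * (g y * ennreal (w y)) \<partial>lebesgue)"
    using AE_V_le
  proof (intro nn_integral_mono_AE, eventually_elim)
    case (elim y)
    have "(\<integral>\<^sup>+x\<in>E. ?k x y \<partial>M) \<le> ennreal (Cp * w y * e powr (1 - 1 / q))"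
      unfolding e_def using elim fin by (intro kernel_integral_le) auto
    also have "\<dots> = ennreal (Cp * e powr (1 - 1 / q)) * ennreal (w y)"
      using Cp_pos w_nonneg by (subst ennreal_mult[symmetric]) (auto simp: mult_ac)
    finally have "g y * (\<integral>\<^sup>+x\<in>E. ?k x y \<partial>M) \<le> g y * (ennreal (Cp * e powr (1 - 1 / q)) * ennreal (w y))"
      by (rule mult_left_mono) simp
    then show ?case by (simp add: mult_ac)
  qed
  also have "\<dots> = ennreal (Cp * e powr (1 - 1 / q)) * ?J"
    by (rule nn_integral_cmult) measurable
  finally have main: "ennreal (l * e) \<le> ennreal (Cp * e powr (1 - 1 / q)) * ?J" .
  have "ennreal (l * e powr (1 / q)) = ennreal (e powr (1 / q - 1)) * ennreal (l * e)"
    using e l by (simp add: powr_diff flip: ennreal_mult)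
  also have "\<dots> \<le> ennreal (e powr (1 / q - 1)) * (ennreal (Cp * e powr (1 - 1 / q)) * ?J)"
    using main by (rule mult_left_mono) simp
  also have "\<dots> = ennreal (e powr (1 / q - 1) * (Cp * e powr (1 - 1 / q))) * ?J"
    using Cp_pos by (simp add: ennreal_mult mult.assoc)
  also have "e powr (1 / q - 1) * (Cp * e powr (1 - 1 / q)) = Cp"
    using e by (simp add: powr_diff)
  finally show ?thesis by (simp add: e_def)
qed

end

section \<open>Estimates on a fixed ball\<close>

context A1q_weight
begin

text \<open>If the distance of y from z lies between 2^k (2r) and 2^(k+1) (2r), then |x - y| is at
  least 2^k r, while y lies in the ball of radius 2^(k+2) r; the quotient 4 of these radii gives the
  constant. The bound is the same for all x in the ball. Summation from j = 0 keeps a place for the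
  dilate 2B, where the near part lives.\<close>

lemma kernel_outside_le:
  assumes r: "0 < r" and x: "x \<in> ball z r" and y: "y \<notin> ball z (2 * r)"
  shows "ennreal (norm (x - y) powr (\<gamma> - n)) \<le>
    (\<Sum>j. ennreal (4 powr (n - \<gamma>)) * (ennreal ((2 ^ Suc j * r) powr (\<gamma> - n)) * indicator (ball z (2 ^ Suc j * r)) y))"
    (is "_ \<le> (\<Sum>j. ?t j)")
proof -
  obtain k where k: "2 ^ k * (2 * r) \<le> dist z y" "dist z y < 2 ^ Suc k * (2 * r)"
    using dyadic_shell_outside[of "2 * r" "dist z y"] r y by auto
  have "1 * r \<le> 2 ^ k * r" using r by (intro mult_right_mono) auto
  then have "2 ^ k * r \<le> dist z y - r" using k(1) by simp
  also have "\<dots> \<le> norm (x - y)"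
    using x dist_triangle[of z y x] by (simp add: dist_norm)
  finally have "norm (x - y) powr (\<gamma> - n) \<le> (2 ^ k * r) powr (\<gamma> - n)"
    using r \<gamma>_less by (intro powr_mono2') auto
  also have "\<dots> = 4 powr (n - \<gamma>) * (2 ^ Suc (Suc k) * r) powr (\<gamma> - n)"
  proof -
    have "(2 ^ Suc (Suc k) * r) = 4 * (2 ^ k * r)" by simp
    then have "(2 ^ Suc (Suc k) * r) powr (\<gamma> - n) = 4 powr (\<gamma> - n) * (2 ^ k * r) powr (\<gamma> - n)"
      by (simp only: powr_mult)
    moreover have "4 powr (n - \<gamma>) * 4 powr (\<gamma> - n) = (1 :: real)"
      by (simp flip: powr_add)
    ultimately show ?thesis by (simp add: mult.assoc[symmetric])
  qed
  finally have "ennreal (norm (x - y) powr (\<gamma> - n)) \<le> ?t (Suc k)"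
    using k(2) by (simp add: ennreal_leI flip: ennreal_mult)
  also have "\<dots> \<le> (\<Sum>j. ?t j)" by (rule ennreal_le_suminf)
  finally show ?thesis .
qed

text \<open>On the whole ball the far part is dominated by one constant, so in a level set estimate
  it only competes with the level l.\<close>

lemma riesz_potential_outside_le:
  assumes [measurable]: "g \<in> borel_measurable lebesgue" and r: "0 < r" and x: "x \<in> ball z r"
  shows "riesz_potential (\<gamma> - n) (\<lambda>y. g y * indicator (- ball z (2 * r)) y) x \<le>
    (\<Sum>j. ennreal (4 powr (n - \<gamma>) * K powr (1 / q) * V z (2 ^ Suc j * r) powr (- (1 / q)))
      * (\<integral>\<^sup>+y\<in>ball z (2 ^ Suc j * r). g y * ennreal (w y) \<partial>lebesgue))"
proof -
  let ?R = "\<lambda>j::nat. 2 ^ Suc j * r"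
  let ?c = "ennreal (4 powr (n - \<gamma>))"
  have "riesz_potential (\<gamma> - n) (\<lambda>y. g y * indicator (- ball z (2 * r)) y) x \<le>
     (\<integral>\<^sup>+y. (\<Sum>j. ?c * (ennreal (?R j powr (\<gamma> - n)) * (g y * indicator (ball z (?R j)) y))) \<partial>lebesgue)"
    unfolding riesz_potential_def
  proof (rule nn_integral_mono)
    fix y
    show "ennreal (norm (x - y) powr (\<gamma> - n)) * (g y * indicator (- ball z (2 * r)) y)
      \<le> (\<Sum>j. ?c * (ennreal (?R j powr (\<gamma> - n)) * (g y * indicator (ball z (?R j)) y)))"
    proof (cases "y \<in> ball z (2 * r)")
      case True
      then show ?thesis by simp
    next
      case False
      have "ennreal (norm (x - y) powr (\<gamma> - n)) * g y
          \<le> (\<Sum>j. ?c * (ennreal (?R j powr (\<gamma> - n)) * indicator (ball z (?R j)) y)) * g y"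
        using kernel_outside_le[OF r x False] by (rule mult_right_mono) simp
      also have "\<dots> = (\<Sum>j. ?c * (ennreal (?R j powr (\<gamma> - n)) * (g y * indicator (ball z (?R j)) y)))"
        by (simp add: mult_ac flip: ennreal_suminf_multc)
      finally show ?thesis using False by simp
    qed
  qed
  also have "\<dots> = (\<Sum>j. \<integral>\<^sup>+y. ?c * (ennreal (?R j powr (\<gamma> - n)) * (g y * indicator (ball z (?R j)) y)) \<partial>lebesgue)"
    by (rule nn_integral_suminf) measurable
  also have "\<dots> = (\<Sum>j. ?c * (ennreal (?R j powr (\<gamma> - n)) * (\<integral>\<^sup>+y\<in>ball z (?R j). g y \<partial>lebesgue)))"
    by (intro suminf_cong) (subst nn_integral_cmult, measurable, subst nn_integral_cmult, measurable)
  also have "\<dots> \<le> (\<Sum>j. ?c * (ennreal (K powr (1 / q) * V z (?R j) powr (- (1 / q)))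
      * (\<integral>\<^sup>+y\<in>ball z (?R j). g y * ennreal (w y) \<partial>lebesgue)))"
    using r by (intro suminf_le mult_left_mono integral_ball_le_weighted) auto
  also have "\<dots> = (\<Sum>j. ennreal (4 powr (n - \<gamma>) * K powr (1 / q) * V z (?R j) powr (- (1 / q)))
      * (\<integral>\<^sup>+y\<in>ball z (?R j). g y * ennreal (w y) \<partial>lebesgue))"
    using K_pos by (simp add: ennreal_mult mult.assoc)
  finally show ?thesis .
qed

lemma V_reverse_doubling_iterate:
  assumes "0 < \<theta>" and rev: "\<And>z r. 0 < r \<Longrightarrow> V z r \<le> \<theta> * V z (2 * r)" and "0 < r"
  shows "V z r \<le> \<theta> ^ j * V z (2 ^ j * r)"
proof (induction j)
  case (Suc j)
  have "V z (2 ^ j * r) \<le> \<theta> * V z (2 * (2 ^ j * r))" using \<open>0 < r\<close> by (intro rev) simp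
  then have "\<theta> ^ j * V z (2 ^ j * r) \<le> \<theta> ^ j * (\<theta> * V z (2 * (2 ^ j * r)))"
    using \<open>0 < \<theta>\<close> by (intro mult_left_mono) auto
  with Suc show ?case by (simp add: mult_ac)
qed simp

text \<open>Let F be the uniform bound for the far part. If l \<le> 2F, the crude bound w^q(E) \<le>
  w^q(B) suffices: the remaining power of w^q(B) is \<delta> = e + 1/q > 0, and reverse doubling
  makes the series for F geometric. Otherwise the far part stays below l/2, so E lies in the
  superlevel set of the near part at level l/2, to which the weak type estimate applies. The sign of
  e lets doubling replace V z r powr e by the same power at radius 2r.\<close>

lemma weak_local_estimate:
  assumes e: "e \<le> 0" "0 < e + 1 / q"
  obtains C \<rho> where "0 < C" "0 < \<rho>" "\<rho> < 1"
    "\<And>g z r l. g \<in> borel_measurable lebesgue \<Longrightarrow> 0 < r \<Longrightarrow> 0 \<le> l \<Longrightarrow>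
      ennreal (l * measure M {x \<in> ball z r. ennreal l < riesz_potential (\<gamma> - n) g x} powr (1 / q) * V z r powr e)
      \<le> ennreal C * (\<Sum>j. ennreal (\<rho> ^ j) * (ennreal (V z (2 ^ Suc j * r) powr e)
           * (\<integral>\<^sup>+y\<in>ball z (2 ^ Suc j * r). g y * ennreal (w y) \<partial>lebesgue)))"
proof -
  obtain \<theta> where \<theta>: "0 < \<theta>" "\<theta> < 1" and rev: "\<And>z r. 0 < r \<Longrightarrow> V z r \<le> \<theta> * V z (2 * r)"
    using V_reverse_doubling by blast
  define \<delta> where "\<delta> = e + 1 / q"
  define \<rho> where "\<rho> = \<theta> powr \<delta>"
  define D where "D = K * 2 powr n / unit_ball_vol n"
  define c where "c = 4 powr (n - \<gamma>) * K powr (1 / q)"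
  \<comment> \<open>One summand for each of the two cases for l; the factors 2 come from l \<le> 2F
    and from halving the level.\<close>
  define C where "C = 2 * c + 2 * Cp * D powr (- e)"
  have \<rho>: "0 < \<rho>" "\<rho> < 1"
    using \<theta> e powr_less_mono2[of \<delta> \<theta> 1] by (auto simp: \<rho>_def \<delta>_def)
  have D: "0 < D" using K_pos unit_ball_vol_n_pos by (simp add: D_def)
  have c: "0 < c" using K_pos by (simp add: c_def)
  have C: "0 < C" using c Cp_pos D by (simp add: C_def add_pos_pos)
  have est: "ennreal (l * measure M {x \<in> ball z r. ennreal l < riesz_potential (\<gamma> - n) g x} powr (1 / q) * V z r powr e)
      \<le> ennreal C * (\<Sum>j. ennreal (\<rho> ^ j) * (ennreal (V z (2 ^ Suc j * r) powr e)
           * (\<integral>\<^sup>+y\<in>ball z (2 ^ Suc j * r). g y * ennreal (w y) \<partial>lebesgue)))"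
    if [measurable]: "g \<in> borel_measurable lebesgue" and r: "0 < r" and l: "0 \<le> l" for g z r l
  proof -
    let ?R = "\<lambda>j::nat. 2 ^ Suc j * r"
    let ?N = "\<lambda>j. \<integral>\<^sup>+y\<in>ball z (?R j). g y * ennreal (w y) \<partial>lebesgue"
    let ?P = "riesz_potential (\<gamma> - n)"
    let ?E = "{x \<in> ball z r. ennreal l < ?P g x}"
    let ?S = "\<Sum>j. ennreal (\<rho> ^ j) * (ennreal (V z (?R j) powr e) * ?N j)"
    define F where "F = (\<Sum>j. ennreal (c * V z (?R j) powr (- (1 / q))) * ?N j)"
    have Vr: "0 < V z r" by (rule V_pos[OF r])
    have VR: "0 < V z (?R j)" for j using r by (intro V_pos) simp
    have E_le: "measure M ?E \<le> V z r"
    proof -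
      have "emeasure M ?E \<le> emeasure M (ball z r)" by (intro emeasure_mono) auto
      then show ?thesis using emeasure_M_ball_finite[of z r]
        unfolding measure_def by (intro enn2real_mono) auto
    qed
    show ?thesis
    proof (cases "ennreal l \<le> 2 * F")
      case True
      have "l * measure M ?E powr (1 / q) * V z r powr e \<le> l * V z r powr (1 / q) * V z r powr e"
        using l E_le q_gt_1 by (intro mult_right_mono mult_left_mono powr_mono2) auto
      also have "\<dots> = l * V z r powr \<delta>"
        by (simp add: \<delta>_def powr_add mult_ac)
      finally have "ennreal (l * measure M ?E powr (1 / q) * V z r powr e) \<le> ennreal l * ennreal (V z r powr \<delta>)"
        using l by (simp add: ennreal_leI flip: ennreal_mult)
      also have "\<dots> \<le> 2 * F * ennreal (V z r powr \<delta>)"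
        using True by (rule mult_right_mono) simp
      also have "\<dots> = 2 * (\<Sum>j. ennreal (c * V z (?R j) powr (- (1 / q))) * ?N j * ennreal (V z r powr \<delta>))"
        unfolding F_def by (subst ennreal_suminf_multc) (rule mult.assoc)
      also have "\<dots> = 2 * (\<Sum>j. ennreal (c * (V z (?R j) powr (- (1 / q)) * V z r powr \<delta>)) * ?N j)"
        using c by (intro arg_cong[where f = "\<lambda>x. 2 * x"] suminf_cong) (simp add: ennreal_mult mult_ac)
      also have "\<dots> \<le> 2 * (\<Sum>j. ennreal c * (ennreal (\<rho> ^ j) * (ennreal (V z (?R j) powr e) * ?N j)))"
      proof (intro mult_left_mono suminf_le)
        fix j :: nat
        have "V z r powr \<delta> \<le> (\<theta> ^ Suc j * V z (?R j)) powr \<delta>"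
          using e Vr V_reverse_doubling_iterate[OF \<theta>(1) rev r, of z "Suc j"]
          by (intro powr_mono2) (auto simp: \<delta>_def)
        also have "\<dots> = \<rho> ^ Suc j * V z (?R j) powr \<delta>"
        proof -
          have "(\<theta> ^ Suc j) powr \<delta> = \<rho> ^ Suc j"
            unfolding powr_realpow[OF \<theta>(1), symmetric] powr_realpow[OF \<rho>(1), symmetric]
            by (simp only: \<rho>_def powr_powr mult.commute)
          then show ?thesis by (simp only: powr_mult)
        qed
        \<comment> \<open>One factor \<rho> is given away so that both cases share the coefficients
          \<rho>^j.\<close>
        also have "\<dots> \<le> \<rho> ^ j * V z (?R j) powr \<delta>"
          using \<rho> by (intro mult_right_mono power_decreasing) auto
        finally have "V z (?R j) powr (- (1 / q)) * V z r powr \<delta>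
            \<le> V z (?R j) powr (- (1 / q)) * (\<rho> ^ j * V z (?R j) powr \<delta>)"
          by (rule mult_left_mono) simp
        also have "\<dots> = \<rho> ^ j * V z (?R j) powr e"
          by (simp add: \<delta>_def mult.left_commute flip: powr_add)
        finally have "ennreal (c * (V z (?R j) powr (- (1 / q)) * V z r powr \<delta>)) \<le> ennreal (c * (\<rho> ^ j * V z (?R j) powr e))"
          using c by (intro ennreal_leI mult_left_mono) auto
        also have "\<dots> = ennreal c * (ennreal (\<rho> ^ j) * ennreal (V z (?R j) powr e))"
          using c \<rho> by (simp add: ennreal_mult)
        finally have "ennreal (c * (V z (?R j) powr (- (1 / q)) * V z r powr \<delta>)) * ?N j
            \<le> ennreal c * (ennreal (\<rho> ^ j) * ennreal (V z (?R j) powr e)) * ?N j"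
          by (rule mult_right_mono) simp
        then show "ennreal (c * (V z (?R j) powr (- (1 / q)) * V z r powr \<delta>)) * ?N j
            \<le> ennreal c * (ennreal (\<rho> ^ j) * (ennreal (V z (?R j) powr e) * ?N j))"
          by (simp only: mult.assoc)
      qed auto
      also have "\<dots> = ennreal (2 * c) * ?S"
        using c by (simp add: ennreal_mult mult.assoc)
      also have "\<dots> \<le> ennreal C * ?S"
        using Cp_pos D by (intro mult_right_mono ennreal_leI) (auto simp: C_def)
      finally show ?thesis .
    next
      case False
      \<comment> \<open>As \<open>?R 0\<close> is 2r, the weighted integral of the near part is
        exactly the term j = 0 of the series.\<close>
      let ?g1 = "\<lambda>y. g y * indicator (ball z (?R 0)) y"
      let ?g2 = "\<lambda>y. g y * indicator (- ball z (2 * r)) y"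
      let ?E1 = "{x \<in> ball z r. ennreal (l / 2) < ?P ?g1 x}"
      have split: "?P g x = ?P ?g1 x + ?P ?g2 x" for x
        unfolding riesz_potential_def
        by (subst nn_integral_add[symmetric]) (auto intro!: nn_integral_cong simp: indicator_def)
      have "?E \<subseteq> ?E1"
      proof
        fix x assume x: "x \<in> ?E"
        have "?P ?g2 x \<le> F"
          using riesz_potential_outside_le[of g r x z] r x by (simp add: F_def c_def)
        with x split[of x] have *: "ennreal l < ?P ?g1 x + F"
          by (auto intro: less_le_trans add_left_mono)
        have F: "2 * F < ennreal l" using False by simp
        then have "F < top" by (cases F) (auto simp: ennreal_mult_top)
        then obtain F' where F': "F = ennreal F'" "0 \<le> F'" by (cases F) auto
        have "2 * F' < l" using F F' by (simp add: ennreal_less_iff flip: ennreal_mult ennreal_numeral)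
        have "ennreal (l / 2) < ?P ?g1 x"
        proof (cases "?P ?g1 x")
          case (real p)
          then show ?thesis using * F' \<open>2 * F' < l\<close> l
            by (simp add: ennreal_less_iff flip: ennreal_plus)
        qed simp
        with x show "x \<in> ?E1" by simp
      qed
      moreover have "{x \<in> space lebesgue. x \<in> ball z r \<and> ennreal (l / 2) < ?P ?g1 x} \<in> sets lebesgue"
        by measurable
      then have E1: "?E1 \<in> sets lebesgue" by simp
      ultimately have "emeasure M ?E \<le> emeasure M ?E1" by (intro emeasure_mono) (simp_all only: sets_wmeasure)
      moreover have E1_fin: "emeasure M ?E1 < \<infinity>"
      proof -
        have "emeasure M ?E1 \<le> emeasure M (ball z r)" by (intro emeasure_mono) auto
        then show ?thesis using emeasure_M_ball_finite[of z r] by (rule le_less_trans)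
      qed
      ultimately have "measure M ?E \<le> measure M ?E1"
        unfolding measure_def by (intro enn2real_mono) auto
      then have "l * measure M ?E powr (1 / q) * V z r powr e
          \<le> l * measure M ?E1 powr (1 / q) * (D powr (- e) * V z (?R 0) powr e)"
      proof (intro mult_mono mult_left_mono powr_mono2)
        have "V z (?R 0) / D \<le> V z r"
          using V_doubling[OF r, of z] D by (simp add: D_def[symmetric] field_simps)
        then have "V z r powr e \<le> (V z (?R 0) / D) powr e"
          using e VR[of 0] D by (intro powr_mono2') auto
        also have "\<dots> = D powr (- e) * V z (?R 0) powr e"
          using D VR[of 0] by (simp add: powr_divide powr_minus field_simps)
        finally show "V z r powr e \<le> D powr (- e) * V z (?R 0) powr e" .
      qed (use l q_gt_1 in auto)
      also have "\<dots> = (2 * D powr (- e) * V z (?R 0) powr e) * (l / 2 * measure M ?E1 powr (1 / q))"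
        by simp
      finally have "ennreal (l * measure M ?E powr (1 / q) * V z r powr e)
          \<le> ennreal (2 * D powr (- e) * V z (?R 0) powr e) * ennreal (l / 2 * measure M ?E1 powr (1 / q))"
        using l by (simp add: ennreal_leI flip: ennreal_mult)
      also have "\<dots> \<le> ennreal (2 * D powr (- e) * V z (?R 0) powr e) * (ennreal Cp * ?N 0)"
      proof (rule mult_left_mono)
        have "ennreal (l / 2 * measure M ?E1 powr (1 / q)) \<le> ennreal Cp * (\<integral>\<^sup>+y. ?g1 y * ennreal (w y) \<partial>lebesgue)"
          using E1_fin l by (intro weak_type_estimate[OF _ E1]) auto
        also have "(\<integral>\<^sup>+y. ?g1 y * ennreal (w y) \<partial>lebesgue) = ?N 0"
          by (intro nn_integral_cong) (simp add: mult_ac)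
        finally show "ennreal (l / 2 * measure M ?E1 powr (1 / q)) \<le> ennreal Cp * ?N 0" .
      qed simp
      also have "\<dots> = ennreal (2 * Cp * D powr (- e)) * (ennreal (\<rho> ^ 0) * (ennreal (V z (?R 0) powr e) * ?N 0))"
        using Cp_pos by (simp add: ennreal_mult mult_ac)
      also have "\<dots> \<le> ennreal (2 * Cp * D powr (- e)) * ?S"
        by (rule mult_left_mono[OF ennreal_le_suminf]) simp
      also have "\<dots> \<le> ennreal C * ?S"
        using c by (intro mult_right_mono ennreal_leI) (auto simp: C_def)
      finally show ?thesis .
    qed
  qed
  show ?thesis using that[OF C \<rho> est] .
qed

end

section \<open>Mixed and weak norms\<close>

lemma Lp_norm_ennreal:
  "0 < t \<Longrightarrow> Lp_norm \<mu> (ennreal t) F = epowr (\<integral>\<^sup>+x. epowr (F x) t \<partial>wmeasure \<mu>) (1 / t)"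
  by (simp add: Lp_norm_def)

lemma AE_finite_of_Lp_norm:
  assumes [measurable]: "F \<in> borel_measurable lebesgue" and s: "0 < s" and fin: "Lp_norm \<mu> s F < \<infinity>"
  shows "AE y in wmeasure \<mu>. F y < \<infinity>"
proof (cases "s = \<infinity>")
  case True
  have "AE y in wmeasure \<mu>. F y \<le> esssup (wmeasure \<mu>) F" by (rule esssup_AE)
  then show ?thesis
    by eventually_elim (use True fin in \<open>auto simp: Lp_norm_def intro: le_less_trans\<close>)
next
  case False
  then obtain t where t: "s = ennreal t" "0 < t" using s by (cases s) auto
  have "(\<integral>\<^sup>+x. epowr (F x) t \<partial>wmeasure \<mu>) \<noteq> \<infinity>"
    using fin t by (auto simp: Lp_norm_ennreal)
  then have "AE y in wmeasure \<mu>. epowr (F y) t \<noteq> \<infinity>"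
    by (intro nn_integral_noteq_infinite) measurable
  then show ?thesis
  proof eventually_elim
    case (elim y)
    then show ?case using t by (cases "F y") auto
  qed
qed

text \<open>
  Minkowski's inequality is avoided: for \<open>\<sigma> = sqrt \<rho>\<close> a geometric sum is at most a multiple of
  \<open>sup\<^sub>k \<sigma>\<^sup>k a\<^sub>k\<close>, and the power of a supremum is at most the sum of the powers.
\<close>

lemma Lp_norm_geometric_sum:
  assumes s: "0 < s" and C: "0 < C" and \<rho>: "0 < \<rho>" "\<rho> < 1"
  obtains C' where "0 < C'"
    "\<And>(\<mu> :: 'a::euclidean_space \<Rightarrow> real) F a N. F \<in> borel_measurable lebesgue \<Longrightarrow>
       (\<And>j. a j \<in> borel_measurable lebesgue) \<Longrightarrow>
       (\<And>y. F y \<le> ennreal C * (\<Sum>j. ennreal (\<rho> ^ j) * a j y)) \<Longrightarrow>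
       (\<And>j. Lp_norm \<mu> s (a j) \<le> N) \<Longrightarrow> Lp_norm \<mu> s F \<le> ennreal C' * N"
proof (cases "s = \<infinity>")
  case True
  define C' where "C' = C * (1 / (1 - \<rho>))"
  have C': "0 < C'" using C \<rho> by (simp add: C'_def)
  show ?thesis
  proof (rule that[OF C'])
    fix \<mu> :: "'a \<Rightarrow> real" and F a N
    assume [measurable]: "F \<in> borel_measurable lebesgue" "\<And>j. a j \<in> borel_measurable lebesgue"
      and F: "\<And>y. F y \<le> ennreal C * (\<Sum>j. ennreal (\<rho> ^ j) * a j y)"
      and N: "\<And>j. Lp_norm \<mu> s (a j) \<le> N"
    have "AE y in wmeasure \<mu>. \<forall>j. a j y \<le> N"
    proof (subst AE_all_countable, rule allI)
      fix j
      have "AE y in wmeasure \<mu>. a j y \<le> esssup (wmeasure \<mu>) (a j)" by (rule esssup_AE)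
      then show "AE y in wmeasure \<mu>. a j y \<le> N"
        by eventually_elim (use N[of j] True in \<open>auto simp: Lp_norm_def\<close>)
    qed
    then have "AE y in wmeasure \<mu>. F y \<le> ennreal C' * N"
    proof eventually_elim
      case (elim y)
      have "F y \<le> ennreal C * (\<Sum>j. ennreal (\<rho> ^ j) * N)"
        using elim by (intro order_trans[OF F] mult_left_mono suminf_le) auto
      also have "\<dots> = ennreal C * (ennreal (1 / (1 - \<rho>)) * N)"
        using \<rho> by (simp only: suminf_geometric_mult)
      also have "\<dots> = ennreal C' * N"
        using C \<rho> unfolding C'_def by (subst ennreal_mult) (auto simp: mult.assoc)
      finally show ?case .
    qed
    then show "Lp_norm \<mu> s F \<le> ennreal C' * N"
      using True by (simp add: Lp_norm_def esssup_I)
  qed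
next
  case False
  then obtain t where t: "s = ennreal t" "0 < t" using s by (cases s) auto
  define \<sigma> where "\<sigma> = sqrt \<rho>"
  have \<sigma>: "0 < \<sigma>" "\<sigma> < 1" "\<rho> = \<sigma> * \<sigma>" using \<rho> by (auto simp: \<sigma>_def)
  define c where "c = C * (1 / (1 - \<sigma>))"
  \<comment> \<open>The ratio of the series after taking t-th powers. No triangle inequality enters,
    so all t > 0 are treated alike.\<close>
  define \<tau> where "\<tau> = \<sigma> powr t"
  have \<tau>: "0 < \<tau>" "\<tau> < 1" using \<sigma> t powr_less_mono2[of t \<sigma> 1] by (auto simp: \<tau>_def)
  define d where "d = c powr t * (1 / (1 - \<tau>))"
  have c: "0 < c" using C \<sigma> by (simp add: c_def)
  have d: "0 < d" using c \<tau> by (simp add: d_def)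
  show ?thesis
  proof (rule that[of "d powr (1 / t)"])
    fix \<mu> :: "'a \<Rightarrow> real" and F a N
    assume [measurable]: "F \<in> borel_measurable lebesgue" "\<And>j. a j \<in> borel_measurable lebesgue"
      and F: "\<And>y. F y \<le> ennreal C * (\<Sum>j. ennreal (\<rho> ^ j) * a j y)"
      and N: "\<And>j. Lp_norm \<mu> s (a j) \<le> N"
    have pointwise: "epowr (F y) t \<le> ennreal (c powr t) * (\<Sum>k. ennreal (\<tau> ^ k) * epowr (a k y) t)" for y
    proof -
      let ?m = "SUP k. ennreal (\<sigma> ^ k) * a k y"
      have "F y \<le> ennreal C * (\<Sum>j. ennreal (\<sigma> ^ j) * ?m)"
      proof (intro order_trans[OF F] mult_left_mono suminf_le)
        fix j
        have "ennreal (\<rho> ^ j) * a j y = ennreal (\<sigma> ^ j) * (ennreal (\<sigma> ^ j) * a j y)"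
          using \<sigma> by (simp add: power_mult_distrib ennreal_mult mult.assoc)
        also have "\<dots> \<le> ennreal (\<sigma> ^ j) * ?m" by (intro mult_left_mono SUP_upper) auto
        finally show "ennreal (\<rho> ^ j) * a j y \<le> ennreal (\<sigma> ^ j) * ?m" .
      qed auto
      also have "\<dots> = ennreal C * (ennreal (1 / (1 - \<sigma>)) * ?m)"
        using \<sigma> by (simp only: suminf_geometric_mult)
      also have "\<dots> = ennreal c * ?m"
        using C \<sigma> unfolding c_def by (subst ennreal_mult) (auto simp: mult.assoc)
      finally have "epowr (F y) t \<le> epowr (ennreal c * ?m) t"
        using t by (intro epowr_mono) auto
      also have "\<dots> = ennreal (c powr t) * (SUP k. epowr (ennreal (\<sigma> ^ k) * a k y) t)"
        using c t by (simp add: epowr_mult_ennreal epowr_SUP)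
      also have "\<dots> \<le> ennreal (c powr t) * (\<Sum>k. ennreal (\<tau> ^ k) * epowr (a k y) t)"
      proof (intro mult_left_mono SUP_least)
        fix k
        have "epowr (ennreal (\<sigma> ^ k) * a k y) t = ennreal (\<tau> ^ k) * epowr (a k y) t"
        proof -
          have "(\<sigma> ^ k) powr t = \<tau> ^ k"
            unfolding powr_realpow[OF \<sigma>(1), symmetric] powr_realpow[OF \<tau>(1), symmetric]
            by (simp only: \<tau>_def powr_powr mult.commute)
          then show ?thesis using \<sigma> t by (simp add: epowr_mult_ennreal)
        qed
        then show "epowr (ennreal (\<sigma> ^ k) * a k y) t \<le> (\<Sum>k. ennreal (\<tau> ^ k) * epowr (a k y) t)"
          by (simp only: ennreal_le_suminf[of "\<lambda>k. ennreal (\<tau> ^ k) * epowr (a k y) t"])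
      qed simp
      finally show ?thesis .
    qed
    have N': "(\<integral>\<^sup>+y. epowr (a k y) t \<partial>wmeasure \<mu>) \<le> epowr N t" for k
    proof -
      have "epowr (epowr (\<integral>\<^sup>+y. epowr (a k y) t \<partial>wmeasure \<mu>) (1 / t)) t \<le> epowr N t"
        using N[of k] t by (intro epowr_mono) (auto simp: Lp_norm_ennreal)
      then show ?thesis using t by (simp add: epowr_epowr)
    qed
    have "(\<integral>\<^sup>+y. epowr (F y) t \<partial>wmeasure \<mu>)
        \<le> (\<integral>\<^sup>+y. ennreal (c powr t) * (\<Sum>k. ennreal (\<tau> ^ k) * epowr (a k y) t) \<partial>wmeasure \<mu>)"
      by (intro nn_integral_mono pointwise)
    also have "\<dots> = ennreal (c powr t) * (\<Sum>k. ennreal (\<tau> ^ k) * (\<integral>\<^sup>+y. epowr (a k y) t \<partial>wmeasure \<mu>))"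
      by (simp add: nn_integral_cmult nn_integral_suminf)
    also have "\<dots> \<le> ennreal (c powr t) * (\<Sum>k. ennreal (\<tau> ^ k) * epowr N t)"
      by (intro mult_left_mono suminf_le N') auto
    also have "\<dots> = ennreal (c powr t) * (ennreal (1 / (1 - \<tau>)) * epowr N t)"
      using \<tau> by (simp only: suminf_geometric_mult)
    also have "\<dots> = ennreal d * epowr N t"
      using \<tau> unfolding d_def by (subst ennreal_mult) (auto simp: mult.assoc)
    finally have "Lp_norm \<mu> s F \<le> epowr (ennreal d * epowr N t) (1 / t)"
      using t by (simp add: Lp_norm_ennreal epowr_mono)
    also have "\<dots> = ennreal (d powr (1 / t)) * N"
      using d t by (simp add: epowr_mult_ennreal epowr_epowr)
    finally show "Lp_norm \<mu> s F \<le> ennreal (d powr (1 / t)) * N" .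
  qed (use d in simp)
qed

text \<open>Multiplication by l and the root of order q are order isomorphisms, so the condition can
  be solved for x. With x the measure of a ball this is the form in which superlevel sets are known
  to be open.\<close>

lemma less_mult_epowr_iff:
  assumes "0 < l" "0 < q"
  shows "c < ennreal l * epowr x (1 / q) \<longleftrightarrow> epowr (ennreal (1 / l) * c) q < x"
proof -
  have l: "ennreal (1 / l) * (ennreal l * u) = u" "ennreal l * (ennreal (1 / l) * u) = u" for u
    using assms by (simp_all add: mult.assoc[symmetric] flip: ennreal_mult)
  have "ennreal l * epowr x (1 / q) \<le> c \<longleftrightarrow> x \<le> epowr (ennreal (1 / l) * c) q"
  proof
    assume "ennreal l * epowr x (1 / q) \<le> c"
    then have "ennreal (1 / l) * (ennreal l * epowr x (1 / q)) \<le> ennreal (1 / l) * c"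
      by (rule mult_left_mono) simp
    then have "epowr (epowr x (1 / q)) q \<le> epowr (ennreal (1 / l) * c) q"
      unfolding l using assms by (intro epowr_mono) auto
    then show "x \<le> epowr (ennreal (1 / l) * c) q" using assms by (simp add: epowr_epowr)
  next
    assume "x \<le> epowr (ennreal (1 / l) * c) q"
    then have "epowr x (1 / q) \<le> epowr (epowr (ennreal (1 / l) * c) q) (1 / q)"
      using assms by (intro epowr_mono) auto
    also have "\<dots> = ennreal (1 / l) * c" using assms by (simp add: epowr_epowr)
    finally have "ennreal l * epowr x (1 / q) \<le> ennreal l * (ennreal (1 / l) * c)"
      by (rule mult_left_mono) simp
    then show "ennreal l * epowr x (1 / q) \<le> c" unfolding l .
  qed
  then show ?thesis by (simp only: not_le[symmetric])
qed

text \<open>The supremum over \<open>l\<close> is uncountable; measurability holds because the superlevel sets are open.\<close>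

lemma borel_measurable_weak_Lp_norm_ball:
  fixes h :: "'a::euclidean_space \<Rightarrow> complex"
  assumes q: "0 < q" and h [measurable]: "h \<in> borel_measurable lebesgue"
  shows "(\<lambda>y. weak_Lp_norm W q (\<lambda>x. indicat_real (ball y r) x *\<^sub>R h x)) \<in> borel_measurable borel"
proof (rule borel_measurableI_greater)
  fix c
  have open_l: "open {y. c < ennreal l * epowr (emeasure (wmeasure W) {x. l < norm (indicat_real (ball y r) x *\<^sub>R h x)}) (1 / q)}"
    if l: "0 < l" for l
  proof -
    let ?E = "{x \<in> space lebesgue. l < norm (h x)}"
    \<comment> \<open>Restricting the measure to the superlevel set of h turns the measure of its
      intersection with a ball into the measure of the ball alone.\<close>
    let ?M = "density (wmeasure W) (indicator ?E)"
    have E: "?E \<in> sets lebesgue" by measurable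
    have "emeasure ?M (ball y r) = emeasure (wmeasure W) {x. l < norm (indicat_real (ball y r) x *\<^sub>R h x)}" for y
    proof -
      have eq: "{x. l < norm (indicat_real (ball y r) x *\<^sub>R h x)} = ?E \<inter> ball y r"
        using l by (auto simp: indicator_def)
      have "emeasure ?M (ball y r) = (\<integral>\<^sup>+x. indicator (?E \<inter> ball y r) x \<partial>wmeasure W)"
        using E by (subst emeasure_density) (auto intro!: nn_integral_cong simp: indicator_def simp del: nn_integral_indicator)
      also have "\<dots> = emeasure (wmeasure W) (?E \<inter> ball y r)"
        using E by (intro nn_integral_indicator) auto
      finally show ?thesis by (simp only: eq)
    qed
    moreover have "open {y. epowr (ennreal (1 / l) * c) q < emeasure ?M (ball y r)}"
      by (rule emeasure_ball_strict_greater_open) auto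
    ultimately show ?thesis using l q by (simp add: less_mult_epowr_iff)
  qed
  have "{y. c < weak_Lp_norm W q (\<lambda>x. indicat_real (ball y r) x *\<^sub>R h x)} =
      (\<Union>l\<in>{0<..}. {y. c < ennreal l * epowr (emeasure (wmeasure W) {x. l < norm (indicat_real (ball y r) x *\<^sub>R h x)}) (1 / q)})"
    unfolding weak_Lp_norm_def less_SUP_iff by auto
  moreover have "open \<dots>" using open_l by (intro open_UN) auto
  ultimately show "{y \<in> space borel. c < weak_Lp_norm W q (\<lambda>x. indicat_real (ball y r) x *\<^sub>R h x)} \<in> sets borel"
    by simp
qed

text \<open>Settles the degenerate weight. The power of w^q(B) in front may be \<infinity>, but
  \<infinity> * 0 = 0.\<close>

lemma weak_amalgam_norm_zero_weight:
  assumes "AE x in lebesgue. W x = 0" and "0 < q" "0 < s"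
  shows "weak_amalgam_norm q s \<beta> W \<mu> h = 0"
proof -
  have "emeasure (wmeasure W) E = 0" for E
  proof (cases "E \<in> sets (wmeasure W)")
    case True
    have "(\<lambda>x. 0 :: real) \<in> borel_measurable lebesgue" by simp
    moreover have "AE x in lebesgue. 0 = W x" using assms(1) by eventually_elim simp
    ultimately have W: "W \<in> borel_measurable lebesgue" by (rule borel_measurable_AE)
    then show ?thesis
      using True assms(1) by (subst emeasure_wmeasure) (auto simp: nn_integral_0_iff_AE elim!: eventually_mono)
  qed (rule emeasure_notin_sets)
  then have "weak_Lp_norm W q g = 0" for g :: "'a \<Rightarrow> complex"
    using assms(2) by (simp add: weak_Lp_norm_def)
  moreover have "Lp_norm \<mu> s (\<lambda>y. 0) = 0"
  proof (cases "s = \<infinity>")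
    case True
    have "esssup (wmeasure \<mu>) (\<lambda>y. 0 :: ennreal) \<le> 0" by (rule esssup_I) simp_all
    with True show ?thesis by (simp add: Lp_norm_def)
  next
    case False
    then obtain t where "s = ennreal t" "0 < t" using assms(3) by (cases s) auto
    then show ?thesis by (simp add: Lp_norm_ennreal)
  qed
  ultimately show ?thesis by (simp add: weak_amalgam_norm_def)
qed

section \<open>Domination by the Riesz potential\<close>

text \<open>The inequality u \<le> exp u for u = x/m, raised to the power m.\<close>

lemma exp_minus_le_powr:
  fixes m x :: real
  assumes "0 < m" "0 < x"
  shows "exp (- x) \<le> m powr m * x powr (- m)"
proof -
  have "x / m \<le> exp (x / m)" using exp_ge_add_one_self[of "x / m"] by linarith
  then have "x \<le> m * exp (x / m)" using assms by (simp add: field_simps)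
  then have "x powr m \<le> (m * exp (x / m)) powr m" using assms by (intro powr_mono2) auto
  also have "\<dots> = m powr m * exp x" using assms by (simp add: powr_mult exp_powr_real)
  finally show ?thesis using assms by (simp add: exp_minus powr_minus field_simps)
qed

text \<open>The time integral is split at the parabolic scale t = d^2. Below it, the exponential is
  traded for the power (t/d^2)^(n/2), which cancels t^(-n/2) and leaves t^(\<gamma>/2-1), integrable
  at 0 because \<gamma> > 0. Above it, the exponential is at most 1 and t^((\<gamma>-n)/2-1) is
  integrable at infinity because \<gamma> < n. Both parts scale like d^(\<gamma>-n).\<close>

lemma heat_kernel_time_integral_le:
  fixes \<gamma> n A :: real
  assumes "0 < \<gamma>" "\<gamma> < n" "0 < A"
  obtains c where "0 < c"
    "\<And>d. 0 < d \<Longrightarrow> (\<integral>\<^sup>+t\<in>{0<..}. ennreal (t powr (- n / 2) * exp (- A * d\<^sup>2 / t) * t powr (\<gamma> / 2 - 1)) \<partial>lebesgue)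
       \<le> ennreal (c * d powr (\<gamma> - n))"
proof -
  \<comment> \<open>The constant of the exponential bound with m = n/2 and x = A d^2 / t; 2/\<gamma>
    and 2/(n-\<gamma>) below come from integrating the two powers of t.\<close>
  define b where "b = (n / 2) powr (n / 2) * A powr (- n / 2)"
  define c where "c = b * (2 / \<gamma>) + 2 / (n - \<gamma>)"
  have b: "0 < b" using assms by (simp add: b_def)
  have c: "0 < c" using b assms by (simp add: c_def add_pos_pos)
  have bound: "(\<integral>\<^sup>+t\<in>{0<..}. ennreal (t powr (- n / 2) * exp (- A * d\<^sup>2 / t) * t powr (\<gamma> / 2 - 1)) \<partial>lebesgue)
       \<le> ennreal (c * d powr (\<gamma> - n))" if d: "0 < d" for d
  proof -
    have d2: "(d\<^sup>2) powr a = d powr (2 * a)" for a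
      using d by (simp add: powr_powr flip: powr_numeral)
    let ?f = "\<lambda>t. b * d powr (- n) * t powr (\<gamma> / 2 - 1)"
    let ?h = "\<lambda>t. t powr ((\<gamma> - n) / 2 - 1)"
    have "(\<integral>\<^sup>+t\<in>{0<..}. ennreal (t powr (- n / 2) * exp (- A * d\<^sup>2 / t) * t powr (\<gamma> / 2 - 1)) \<partial>lebesgue)
      \<le> (\<integral>\<^sup>+t. ennreal (indicator {0..d\<^sup>2} t * ?f t) + ennreal (indicator {d\<^sup>2..} t * ?h t) \<partial>lebesgue)"
    proof (rule nn_integral_mono)
      fix t :: real
      show "ennreal (t powr (- n / 2) * exp (- A * d\<^sup>2 / t) * t powr (\<gamma> / 2 - 1)) * indicator {0<..} t
        \<le> ennreal (indicator {0..d\<^sup>2} t * ?f t) + ennreal (indicator {d\<^sup>2..} t * ?h t)"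
      proof (cases "0 < t")
        case True
        show ?thesis
        proof (cases "t \<le> d\<^sup>2")
          case le: True
          have "exp (- (A * d\<^sup>2 / t)) \<le> (n / 2) powr (n / 2) * (A * d\<^sup>2 / t) powr (- (n / 2))"
            using assms d True by (intro exp_minus_le_powr) auto
          also have "(A * d\<^sup>2 / t) powr (- (n / 2)) = A powr (- n / 2) * d powr (- n) * t powr (n / 2)"
            using True by (simp add: powr_mult powr_divide d2) (simp add: powr_minus field_simps)
          finally have "exp (- A * d\<^sup>2 / t) \<le> b * d powr (- n) * t powr (n / 2)"
            by (simp add: b_def mult_ac)
          then have "t powr (- n / 2) * exp (- A * d\<^sup>2 / t) * t powr (\<gamma> / 2 - 1)
            \<le> t powr (- n / 2) * (b * d powr (- n) * t powr (n / 2)) * t powr (\<gamma> / 2 - 1)"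
            by (intro mult_right_mono mult_left_mono) auto
          also have "\<dots> = b * d powr (- n) * (t powr (- n / 2) * t powr (n / 2) * t powr (\<gamma> / 2 - 1))"
            by (simp add: mult_ac)
          also have "t powr (- n / 2) * t powr (n / 2) * t powr (\<gamma> / 2 - 1) = t powr (\<gamma> / 2 - 1)"
            using True by (simp flip: powr_add)
          finally have "ennreal (t powr (- n / 2) * exp (- A * d\<^sup>2 / t) * t powr (\<gamma> / 2 - 1)) * indicator {0<..} t
              \<le> ennreal (indicator {0..d\<^sup>2} t * ?f t)"
            using True le by (simp add: ennreal_leI)
          then show ?thesis by (rule add_increasing2[rotated]) simp
        next
          case False
          have "exp (- A * d\<^sup>2 / t) \<le> 1" using assms True by simp
          then have "t powr (- n / 2) * exp (- A * d\<^sup>2 / t) * t powr (\<gamma> / 2 - 1)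
              \<le> t powr (- n / 2) * 1 * t powr (\<gamma> / 2 - 1)"
            by (intro mult_right_mono mult_left_mono) auto
          also have "\<dots> = ?h t" by (simp add: diff_divide_distrib algebra_simps flip: powr_add)
          finally have "ennreal (t powr (- n / 2) * exp (- A * d\<^sup>2 / t) * t powr (\<gamma> / 2 - 1)) * indicator {0<..} t
              \<le> ennreal (indicator {d\<^sup>2..} t * ?h t)"
            using True False by (simp add: ennreal_leI)
          then show ?thesis by (rule add_increasing[rotated]) simp
        qed
      qed simp
    qed
    also have "\<dots> = (\<integral>\<^sup>+t. ennreal (indicator {0..d\<^sup>2} t * ?f t) \<partial>lborel)
        + (\<integral>\<^sup>+t. ennreal (indicator {d\<^sup>2..} t * ?h t) \<partial>lborel)"
      by (simp add: nn_integral_add nn_integral_completion)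
    also have "(\<integral>\<^sup>+t. ennreal (indicator {0..d\<^sup>2} t * ?f t) \<partial>lborel)
        = ennreal (b * d powr (- n) * ((d\<^sup>2) powr (\<gamma> / 2 - 1 + 1) / (\<gamma> / 2 - 1 + 1)))"
      using assms b
      by (intro nn_integral_has_integral_lebesgue has_integral_mult_right has_integral_powr_from_0) auto
    also have "(\<integral>\<^sup>+t. ennreal (indicator {d\<^sup>2..} t * ?h t) \<partial>lborel)
        = ennreal (- ((d\<^sup>2) powr ((\<gamma> - n) / 2 - 1 + 1)) / ((\<gamma> - n) / 2 - 1 + 1))"
      using assms d by (intro nn_integral_has_integral_lebesgue has_integral_powr_to_inf) auto
    also have "- ((d\<^sup>2) powr ((\<gamma> - n) / 2 - 1 + 1)) / ((\<gamma> - n) / 2 - 1 + 1) = 2 / (n - \<gamma>) * d powr (\<gamma> - n)"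
    proof -
      have "2 * ((\<gamma> - n) / 2 - 1 + 1) = \<gamma> - n" "(\<gamma> - n) / 2 - 1 + 1 = - ((n - \<gamma>) / 2)"
        by (simp_all add: field_simps)
      then show ?thesis by (simp only: d2) simp
    qed
    also have "b * d powr (- n) * ((d\<^sup>2) powr (\<gamma> / 2 - 1 + 1) / (\<gamma> / 2 - 1 + 1)) = b * (2 / \<gamma>) * d powr (\<gamma> - n)"
    proof -
      have "d powr (- n) * d powr \<gamma> = d powr (\<gamma> - n)" by (simp flip: powr_add)
      then show ?thesis using assms by (simp add: d2 mult_ac)
    qed
    also have "ennreal (b * (2 / \<gamma>) * d powr (\<gamma> - n)) + ennreal (2 / (n - \<gamma>) * d powr (\<gamma> - n))
        = ennreal (c * d powr (\<gamma> - n))"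
      using assms b by (subst ennreal_plus[symmetric]) (auto simp: c_def algebra_simps)
    finally show ?thesis .
  qed
  show ?thesis by (rule that[OF c bound])
qed

text \<open>The Gaussian majorant is inserted before the integrals are exchanged, so Tonelli is
  applied to an explicit measurable integrand; the null set y = x is discarded. The constant is
  chosen before p, f and x.\<close>

lemma nn_integral_kernel_le_riesz_potential:
  fixes \<gamma> C\<^sub>0 A :: real
  assumes "0 < \<gamma>" "\<gamma> < real DIM('a)" "0 < A" "0 < C\<^sub>0"
  obtains c where "0 < c"
    "\<And>(p :: real \<Rightarrow> 'a::euclidean_space \<Rightarrow> 'a \<Rightarrow> complex) f x.
      (\<And>t x y. 0 < t \<Longrightarrow> norm (p t x y) \<le> C\<^sub>0 * t powr (- real DIM('a) / 2) * exp (- A * (norm (x - y))\<^sup>2 / t)) \<Longrightarrow>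
      (f :: 'a \<Rightarrow> complex) \<in> borel_measurable lebesgue \<Longrightarrow>
      (\<integral>\<^sup>+t\<in>{0<..}. (\<integral>\<^sup>+y. ennreal (norm (p t x y * f y)) \<partial>lebesgue) * ennreal (t powr (\<gamma> / 2 - 1)) \<partial>lebesgue)
        \<le> ennreal c * riesz_potential (\<gamma> - real DIM('a)) (\<lambda>y. ennreal (norm (f y))) x"
proof -
  let ?n = "real DIM('a)"
  let ?G = "\<lambda>d t. t powr (- ?n / 2) * exp (- A * d\<^sup>2 / t) * t powr (\<gamma> / 2 - 1)"
  obtain c where c: "0 < c"
    "\<And>d. 0 < d \<Longrightarrow> (\<integral>\<^sup>+t\<in>{0<..}. ennreal (?G d t) \<partial>lebesgue) \<le> ennreal (c * d powr (\<gamma> - ?n))"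
    using heat_kernel_time_integral_le[OF assms(1-3)] by blast
  show ?thesis
  proof (rule that[of "C\<^sub>0 * c"])
    fix p :: "real \<Rightarrow> 'a \<Rightarrow> 'a \<Rightarrow> complex" and f :: "'a \<Rightarrow> complex" and x
    assume p: "\<And>t x y. 0 < t \<Longrightarrow> norm (p t x y) \<le> C\<^sub>0 * t powr (- ?n / 2) * exp (- A * (norm (x - y))\<^sup>2 / t)"
      and [measurable]: "f \<in> borel_measurable lebesgue"
    let ?H = "\<lambda>t y. ennreal (norm (f y)) * (ennreal C\<^sub>0 * (ennreal (?G (norm (x - y)) t) * indicator {0<..} t))"
    have "(\<integral>\<^sup>+t\<in>{0<..}. (\<integral>\<^sup>+y. ennreal (norm (p t x y * f y)) \<partial>lebesgue) * ennreal (t powr (\<gamma> / 2 - 1)) \<partial>lebesgue)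
      \<le> (\<integral>\<^sup>+t. \<integral>\<^sup>+y. ?H t y \<partial>lebesgue \<partial>lebesgue)"
    proof (rule nn_integral_mono)
      fix t :: real
      show "(\<integral>\<^sup>+y. ennreal (norm (p t x y * f y)) \<partial>lebesgue) * ennreal (t powr (\<gamma> / 2 - 1)) * indicator {0<..} t
        \<le> (\<integral>\<^sup>+y. ?H t y \<partial>lebesgue)"
      proof (cases "0 < t")
        case True
        have "(\<integral>\<^sup>+y. ennreal (norm (p t x y * f y)) \<partial>lebesgue) * ennreal (t powr (\<gamma> / 2 - 1))
          \<le> (\<integral>\<^sup>+y. ennreal (C\<^sub>0 * t powr (- ?n / 2) * exp (- A * (norm (x - y))\<^sup>2 / t) * norm (f y)) \<partial>lebesgue)
              * ennreal (t powr (\<gamma> / 2 - 1))"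
          using p[OF True]
          by (intro mult_right_mono nn_integral_mono ennreal_leI) (auto simp: norm_mult intro!: mult_right_mono)
        also have "\<dots> = (\<integral>\<^sup>+y. ennreal (C\<^sub>0 * t powr (- ?n / 2) * exp (- A * (norm (x - y))\<^sup>2 / t) * norm (f y))
              * ennreal (t powr (\<gamma> / 2 - 1)) \<partial>lebesgue)"
          by (rule nn_integral_multc[symmetric]) measurable
        also have "\<dots> = (\<integral>\<^sup>+y. ?H t y \<partial>lebesgue)"
          using True assms by (intro nn_integral_cong) (simp add: mult_ac flip: ennreal_mult)
        finally show ?thesis using True by simp
      qed simp
    qed
    also have "\<dots> = (\<integral>\<^sup>+y. \<integral>\<^sup>+t. ?H t y \<partial>lebesgue \<partial>lebesgue)"
      by (rule lebesgue_pair.Fubini'[symmetric]) measurable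
    also have "\<dots> \<le> (\<integral>\<^sup>+y. ennreal (C\<^sub>0 * c) * (ennreal (norm (x - y) powr (\<gamma> - ?n)) * ennreal (norm (f y))) \<partial>lebesgue)"
      using AE_completion[OF AE_lborel_singleton[of x]]
    proof (intro nn_integral_mono_AE, eventually_elim)
      case (elim y)
      have "(\<integral>\<^sup>+t. ?H t y \<partial>lebesgue) = ennreal (norm (f y)) * (ennreal C\<^sub>0 * (\<integral>\<^sup>+t\<in>{0<..}. ennreal (?G (norm (x - y)) t) \<partial>lebesgue))"
        by (subst nn_integral_cmult, measurable, subst nn_integral_cmult, measurable)
      also have "\<dots> \<le> ennreal (norm (f y)) * (ennreal C\<^sub>0 * ennreal (c * norm (x - y) powr (\<gamma> - ?n)))"
        using elim by (intro mult_left_mono c(2)) auto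
      also have "\<dots> = ennreal (C\<^sub>0 * c) * (ennreal (norm (x - y) powr (\<gamma> - ?n)) * ennreal (norm (f y)))"
        using c(1) assms by (simp add: mult_ac flip: ennreal_mult)
      finally show ?case .
    qed
    also have "\<dots> = ennreal (C\<^sub>0 * c) * riesz_potential (\<gamma> - ?n) (\<lambda>y. ennreal (norm (f y))) x"
      unfolding riesz_potential_def by (rule nn_integral_cmult) measurable
    finally show "(\<integral>\<^sup>+t\<in>{0<..}. (\<integral>\<^sup>+y. ennreal (norm (p t x y * f y)) \<partial>lebesgue) * ennreal (t powr (\<gamma> / 2 - 1)) \<partial>lebesgue)
        \<le> ennreal (C\<^sub>0 * c) * riesz_potential (\<gamma> - ?n) (\<lambda>y. ennreal (norm (f y))) x" .
  qed (use c(1) assms in simp)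
qed

text \<open>For a non-integrable function the left side is the default 0, so the operator can be
  bounded everywhere before its convergence is known.\<close>

lemma ennreal_norm_integral_le:
  fixes f :: "'a \<Rightarrow> 'b::{banach, second_countable_topology}"
  shows "ennreal (norm (integral\<^sup>L M f)) \<le> (\<integral>\<^sup>+x. ennreal (norm (f x)) \<partial>M)"
  by (cases "integrable M f") (auto simp: integral_norm_bound_ennreal not_integrable_integral_eq)

lemma norm_frac_integral_le:
  "ennreal (norm (frac_integral p \<gamma> f x)) \<le> ennreal \<bar>1 / Gamma (\<gamma> / 2)\<bar> *
     (\<integral>\<^sup>+t\<in>{0<..}. (\<integral>\<^sup>+y. ennreal (norm (p t x y * f y)) \<partial>lebesgue) * ennreal (t powr (\<gamma> / 2 - 1)) \<partial>lebesgue)"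
proof -
  let ?J = "LINT t:{0<..}|lebesgue. semigroup_integral p t f x * complex_of_real (t powr (\<gamma> / 2 - 1))"
  have "ennreal (norm ?J) \<le> (\<integral>\<^sup>+t. ennreal (norm (indicat_real {0<..} t *\<^sub>R
      (semigroup_integral p t f x * complex_of_real (t powr (\<gamma> / 2 - 1))))) \<partial>lebesgue)"
    unfolding set_lebesgue_integral_def by (rule ennreal_norm_integral_le)
  also have "\<dots> \<le> (\<integral>\<^sup>+t\<in>{0<..}. (\<integral>\<^sup>+y. ennreal (norm (p t x y * f y)) \<partial>lebesgue) * ennreal (t powr (\<gamma> / 2 - 1)) \<partial>lebesgue)"
  proof (rule nn_integral_mono)
    fix t :: real
    have "ennreal (norm (semigroup_integral p t f x)) * ennreal (t powr (\<gamma> / 2 - 1))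
      \<le> (\<integral>\<^sup>+y. ennreal (norm (p t x y * f y)) \<partial>lebesgue) * ennreal (t powr (\<gamma> / 2 - 1))"
      unfolding semigroup_integral_def by (intro mult_right_mono ennreal_norm_integral_le) simp
    then show "ennreal (norm (indicat_real {0<..} t *\<^sub>R (semigroup_integral p t f x * complex_of_real (t powr (\<gamma> / 2 - 1)))))
      \<le> (\<integral>\<^sup>+y. ennreal (norm (p t x y * f y)) \<partial>lebesgue) * ennreal (t powr (\<gamma> / 2 - 1)) * indicator {0<..} t"
      by (cases "0 < t") (auto simp: norm_mult ennreal_mult)
  qed
  finally have "ennreal \<bar>1 / Gamma (\<gamma> / 2)\<bar> * ennreal (norm ?J) \<le> ennreal \<bar>1 / Gamma (\<gamma> / 2)\<bar> *
     (\<integral>\<^sup>+t\<in>{0<..}. (\<integral>\<^sup>+y. ennreal (norm (p t x y * f y)) \<partial>lebesgue) * ennreal (t powr (\<gamma> / 2 - 1)) \<partial>lebesgue)"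
    by (rule mult_left_mono) simp
  then show ?thesis
    unfolding frac_integral_def norm_mult norm_of_real by (simp only: ennreal_mult abs_ge_zero norm_ge_zero)
qed

section \<open>Measurability and convergence of the fractional integral\<close>

lemma completion_ex_borel_measurable_complex:
  fixes g :: "'a \<Rightarrow> complex"
  assumes "g \<in> borel_measurable (completion M)"
  shows "\<exists>g'\<in>borel_measurable M. AE x in M. g x = g' x"
proof -
  have "(\<lambda>x. Re (g x)) \<in> borel_measurable (completion M)" "(\<lambda>x. Im (g x)) \<in> borel_measurable (completion M)"
    using assms by auto
  then obtain u v where uv: "u \<in> borel_measurable M" "AE x in M. Re (g x) = u x"
    "v \<in> borel_measurable M" "AE x in M. Im (g x) = v x"
    using completion_ex_borel_measurable_real by metis
  have "AE x in M. g x = Complex (u x) (v x)"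
    using uv(2,4) by eventually_elim (simp add: complex_eq_iff)
  moreover have "(\<lambda>x. Complex (u x) (v x)) \<in> borel_measurable M"
    unfolding borel_measurable_complex_iff using uv by simp
  ultimately show ?thesis by (rule bexI)
qed

text \<open>Fubini yields the quantifiers in the order t, x, y. Moving x to the front requires a
  measurable set of pairs, so the exceptional set is enlarged to a Borel null set N and the
  innermost quantifier is rewritten as the vanishing of an integral of its indicator.\<close>

lemma AE_lborel_triple:
  fixes Q :: "'a::euclidean_space \<times> 'b::euclidean_space \<times> 'c::euclidean_space \<Rightarrow> bool"
  assumes "AE z in lborel. Q z"
  shows "AE x in lborel. AE t in lborel. AE y in lborel. Q (t, x, y)"
proof -
  obtain N :: "('a \<times> 'b \<times> 'c) set" where N: "N \<in> null_sets lborel" "{z. \<not> Q z} \<subseteq> N"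
    using assms by (auto simp: eventually_ae_filter)
  have [measurable]: "N \<in> sets (borel \<Otimes>\<^sub>M (borel \<Otimes>\<^sub>M borel))"
    unfolding borel_prod using N(1) by auto
  have "AE z in lborel \<Otimes>\<^sub>M lborel. z \<notin> N"
    unfolding lborel_prod by (rule AE_not_in[OF N(1)])
  then have "AE t in lborel. AE z in lborel. (t, z) \<notin> N"
    by (rule lborel_pair.AE_pair)
  then have *: "AE t in lborel. AE x in lborel. AE y in lborel. (t, x, y) \<notin> N"
    unfolding lborel_prod[symmetric] by eventually_elim (rule lborel_pair.AE_pair)
  have eq: "(AE y in lborel. (t, x, y) \<notin> N) \<longleftrightarrow> (\<integral>\<^sup>+y. indicator N (t, x, y) \<partial>lborel) = 0" for t x
  proof -
    have "(\<lambda>y. indicator N (t, x, y) :: ennreal) \<in> borel_measurable lborel" by measurable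
    then show ?thesis by (simp add: nn_integral_0_iff_AE indicator_def)
  qed
  have "AE x in lborel. AE t in lborel. AE y in lborel. (t, x, y) \<notin> N"
  proof -
    have "{z \<in> space (lborel \<Otimes>\<^sub>M lborel). (\<integral>\<^sup>+y. indicator N (fst z, snd z, y) \<partial>lborel) = 0}
        \<in> sets (lborel \<Otimes>\<^sub>M lborel)"
      by measurable
    from lborel_pair.AE_commute[OF this] * show ?thesis unfolding eq by blast
  qed
  then show ?thesis
  proof eventually_elim
    case (elim x)
    then show ?case
    proof eventually_elim
      case (elim t)
      then show ?case by eventually_elim (use N(2) in auto)
    qed
  qed
qed

context
  fixes p :: "real \<Rightarrow> 'a::euclidean_space \<Rightarrow> 'a \<Rightarrow> complex" and f :: "'a \<Rightarrow> complex"
  assumes p: "(\<lambda>(t, x, y). p t x y) \<in> borel_measurable (lebesgue_on ({0<..} \<times> UNIV))"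
    and f: "f \<in> borel_measurable lebesgue"
begin

text \<open>Joint Lebesgue measurability of the kernel says nothing about an individual section.
  Borel versions P of the kernel and g of f agree with them on almost all sections, and integrals of
  P times g over y depend on (x, t) in a Borel measurable way.\<close>

lemma semigroup_integral_representative:
  obtains U :: "'a \<Rightarrow> real \<Rightarrow> complex" and B :: "'a \<Rightarrow> real \<Rightarrow> ennreal" where
    "(\<lambda>(x, t). U x t) \<in> borel_measurable (borel \<Otimes>\<^sub>M borel)"
    "(\<lambda>(x, t). B x t) \<in> borel_measurable (borel \<Otimes>\<^sub>M borel)"
    "AE x in lebesgue. AE t in lebesgue. 0 < t \<longrightarrow>
       (\<lambda>y. p t x y * f y) \<in> borel_measurable lebesgue \<and> semigroup_integral p t f x = U x t \<and>
       (\<integral>\<^sup>+y. ennreal (norm (p t x y * f y)) \<partial>lebesgue) = B x t"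
proof -
  let ?\<Omega> = "({0<..} :: real set) \<times> (UNIV :: ('a \<times> 'a) set)"
  have "open ?\<Omega>" by (intro open_Times) auto
  then have "?\<Omega> \<in> sets lebesgue" by (intro sets_completionI_sets) simp
  \<comment> \<open>Extension by zero to t \<le> 0, so that a Borel version on the whole space
    exists.\<close>
  then have "(\<lambda>z. indicator ?\<Omega> z *\<^sub>R (case z of (t, x, y) \<Rightarrow> p t x y)) \<in> borel_measurable lebesgue"
    using p by (subst (asm) borel_measurable_restrict_space_iff) auto
  then obtain P where P: "P \<in> borel_measurable lborel"
    "AE z in lborel. indicator ?\<Omega> z *\<^sub>R (case z of (t, x, y) \<Rightarrow> p t x y) = P z"
    using completion_ex_borel_measurable_complex by blast
  obtain g where g: "g \<in> borel_measurable lborel" "AE y in lborel. f y = g y"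
    using completion_ex_borel_measurable_complex[OF f] by blast
  have [measurable]: "P \<in> borel_measurable (borel \<Otimes>\<^sub>M (borel \<Otimes>\<^sub>M borel))" "g \<in> borel_measurable borel"
    unfolding borel_prod using P(1) g(1) by simp_all
  define U where "U x t = (\<integral>y. P (t, x, y) * g y \<partial>lborel)" for x t
  define B where "B x t = (\<integral>\<^sup>+y. ennreal (norm (P (t, x, y) * g y)) \<partial>lborel)" for x t
  have "(\<lambda>(x, t). U x t) \<in> borel_measurable (borel \<Otimes>\<^sub>M borel)"
    unfolding U_def by measurable
  moreover have "(\<lambda>(x, t). B x t) \<in> borel_measurable (borel \<Otimes>\<^sub>M borel)"
    unfolding B_def by measurable
  moreover have "AE x in lborel. AE t in lborel. 0 < t \<longrightarrow>
       (\<lambda>y. p t x y * f y) \<in> borel_measurable lebesgue \<and> semigroup_integral p t f x = U x t \<and>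
       (\<integral>\<^sup>+y. ennreal (norm (p t x y * f y)) \<partial>lebesgue) = B x t"
    using AE_lborel_triple[OF P(2)]
  proof eventually_elim
    case (elim x)
    then show ?case
    proof eventually_elim
      case (elim t)
      show ?case
      proof
        assume t: "0 < t"
        have ae: "AE y in lborel. P (t, x, y) * g y = p t x y * f y"
          using elim g(2) by eventually_elim (use t in auto)
        have "(\<lambda>y. P (t, x, y) * g y) \<in> borel_measurable borel" by measurable
        then have m: "(\<lambda>y. P (t, x, y) * g y) \<in> borel_measurable lborel" by simp
        then have m': "(\<lambda>y. P (t, x, y) * g y) \<in> borel_measurable lebesgue"
          by (rule measurable_completion)
        have m2: "(\<lambda>y. p t x y * f y) \<in> borel_measurable lebesgue"
          by (rule borel_measurable_AE[OF m' AE_completion[OF ae]])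
        have "semigroup_integral p t f x = (\<integral>y. P (t, x, y) * g y \<partial>lebesgue)"
          unfolding semigroup_integral_def
          using AE_completion[OF ae] by (intro integral_cong_AE m2 m') auto
        also have "\<dots> = U x t"
          unfolding U_def by (rule integral_completion[OF m])
        finally have U: "semigroup_integral p t f x = U x t" .
        have "(\<integral>\<^sup>+y. ennreal (norm (p t x y * f y)) \<partial>lborel) = B x t"
          unfolding B_def using ae by (intro nn_integral_cong_AE, eventually_elim) simp
        with U m2 show "(\<lambda>y. p t x y * f y) \<in> borel_measurable lebesgue \<and> semigroup_integral p t f x = U x t \<and>
            (\<integral>\<^sup>+y. ennreal (norm (p t x y * f y)) \<partial>lebesgue) = B x t"
          by (simp add: nn_integral_completion)
      qed
    qed
  qed
  ultimately show ?thesis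
    using that unfolding AE_completion_iff by blast
qed

lemma borel_measurable_frac_integral: "frac_integral p \<gamma> f \<in> borel_measurable lebesgue"
proof -
  obtain U B where U [measurable]: "(\<lambda>(x, t). U x t) \<in> borel_measurable (borel \<Otimes>\<^sub>M borel)"
    and B [measurable]: "(\<lambda>(x, t). B x t) \<in> borel_measurable (borel \<Otimes>\<^sub>M borel)"
    and ae: "AE x in lebesgue. AE t in lebesgue. 0 < t \<longrightarrow>
       (\<lambda>y. p t x y * f y) \<in> borel_measurable lebesgue \<and> semigroup_integral p t f x = U x t \<and>
       (\<integral>\<^sup>+y. ennreal (norm (p t x y * f y)) \<partial>lebesgue) = B x t"
    using semigroup_integral_representative by blast
  let ?h = "\<lambda>x t. indicat_real {0<..} t *\<^sub>R (U x t * complex_of_real (t powr (\<gamma> / 2 - 1)))"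
  have "(\<lambda>x. complex_of_real (1 / Gamma (\<gamma> / 2)) * (\<integral>t. ?h x t \<partial>lborel)) \<in> borel_measurable borel"
    by measurable
  then have m: "(\<lambda>x. complex_of_real (1 / Gamma (\<gamma> / 2)) * (\<integral>t. ?h x t \<partial>lborel)) \<in> borel_measurable lebesgue"
    by (intro measurable_completion) simp
  show ?thesis
  proof (rule borel_measurable_AE[OF m])
    show "AE x in lebesgue. complex_of_real (1 / Gamma (\<gamma> / 2)) * (\<integral>t. ?h x t \<partial>lborel) = frac_integral p \<gamma> f x"
      using ae
    proof eventually_elim
      case (elim x)
      let ?s = "\<lambda>t. indicat_real {0<..} t *\<^sub>R (semigroup_integral p t f x * complex_of_real (t powr (\<gamma> / 2 - 1)))"
      have eq: "AE t in lebesgue. ?h x t = ?s t"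
        using elim by eventually_elim (auto simp: indicator_def)
      have "?h x \<in> borel_measurable borel" by measurable
      then have h: "?h x \<in> borel_measurable lborel" by simp
      then have h': "?h x \<in> borel_measurable lebesgue" by (rule measurable_completion)
      have "?s \<in> borel_measurable lebesgue" by (rule borel_measurable_AE[OF h' eq])
      then have "integral\<^sup>L lebesgue (?h x) = integral\<^sup>L lebesgue ?s"
        by (intro integral_cong_AE h' eq)
      then show ?case
        by (simp add: frac_integral_def set_lebesgue_integral_def integral_completion[OF h])
    qed
  qed
qed

lemma AE_frac_integral_converges:
  assumes "AE x in lebesgue.
     (\<integral>\<^sup>+t\<in>{0<..}. (\<integral>\<^sup>+y. ennreal (norm (p t x y * f y)) \<partial>lebesgue) * ennreal (t powr (\<gamma> / 2 - 1)) \<partial>lebesgue) < \<infinity>"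
  shows "AE x in lebesgue. frac_integral_converges p \<gamma> f x"
proof -
  obtain U B where U [measurable]: "(\<lambda>(x, t). U x t) \<in> borel_measurable (borel \<Otimes>\<^sub>M borel)"
    and B [measurable]: "(\<lambda>(x, t). B x t) \<in> borel_measurable (borel \<Otimes>\<^sub>M borel)"
    and ae: "AE x in lebesgue. AE t in lebesgue. 0 < t \<longrightarrow>
       (\<lambda>y. p t x y * f y) \<in> borel_measurable lebesgue \<and> semigroup_integral p t f x = U x t \<and>
       (\<integral>\<^sup>+y. ennreal (norm (p t x y * f y)) \<partial>lebesgue) = B x t"
    using semigroup_integral_representative by blast
  show ?thesis
    using ae assms
  proof eventually_elim
    case (elim x)
    let ?N = "\<lambda>t. \<integral>\<^sup>+y. ennreal (norm (p t x y * f y)) \<partial>lebesgue"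
    let ?h = "\<lambda>t. indicat_real {0<..} t *\<^sub>R (U x t * complex_of_real (t powr (\<gamma> / 2 - 1)))"
    let ?s = "\<lambda>t. indicat_real {0<..} t *\<^sub>R (semigroup_integral p t f x * complex_of_real (t powr (\<gamma> / 2 - 1)))"
    have eq: "AE t in lebesgue. ?h t = ?s t"
      using elim(1) by eventually_elim (auto simp: indicator_def)
    have "?h \<in> borel_measurable borel" by measurable
    then have "?h \<in> borel_measurable lborel" by simp
    then have "?h \<in> borel_measurable lebesgue" by (rule measurable_completion)
    then have s: "?s \<in> borel_measurable lebesgue" by (rule borel_measurable_AE[OF _ eq])
    have "(\<integral>\<^sup>+t. ennreal (norm (?s t)) \<partial>lebesgue) \<le> (\<integral>\<^sup>+t\<in>{0<..}. ?N t * ennreal (t powr (\<gamma> / 2 - 1)) \<partial>lebesgue)"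
    proof (rule nn_integral_mono)
      fix t :: real
      have "ennreal (norm (semigroup_integral p t f x)) * ennreal (t powr (\<gamma> / 2 - 1)) \<le> ?N t * ennreal (t powr (\<gamma> / 2 - 1))"
        unfolding semigroup_integral_def by (intro mult_right_mono ennreal_norm_integral_le) simp
      then show "ennreal (norm (?s t)) \<le> ?N t * ennreal (t powr (\<gamma> / 2 - 1)) * indicator {0<..} t"
        by (cases "0 < t") (auto simp: norm_mult ennreal_mult)
    qed
    also have "\<dots> < \<infinity>" by (rule elim(2))
    finally have "integrable lebesgue ?s" using s by (intro integrableI_bounded)
    moreover have "AE t in lebesgue. 0 < t \<longrightarrow> integrable lebesgue (\<lambda>y. p t x y * f y)"
    proof -
      \<comment> \<open>The Borel function B replaces the inner integral, so that a finite integral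
        gives finiteness for almost every t; the power of t is positive for t > 0 and can be
        removed.\<close>
      let ?b = "\<lambda>t. B x t * ennreal (t powr (\<gamma> / 2 - 1)) * indicator {0<..} t"
      have "(\<integral>\<^sup>+t. ?b t \<partial>lebesgue) = (\<integral>\<^sup>+t\<in>{0<..}. ?N t * ennreal (t powr (\<gamma> / 2 - 1)) \<partial>lebesgue)"
        using elim(1) by (intro nn_integral_cong_AE, eventually_elim) (auto simp: indicator_def)
      then have "(\<integral>\<^sup>+t. ?b t \<partial>lebesgue) \<noteq> \<infinity>" using elim(2) by simp
      then have "(\<integral>\<^sup>+t. ?b t \<partial>lborel) \<noteq> \<infinity>" by (simp add: nn_integral_completion)
      moreover have "?b \<in> borel_measurable borel" by measurable
      then have "?b \<in> borel_measurable lborel" by simp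
      ultimately have "AE t in lborel. ?b t \<noteq> \<infinity>" by (intro nn_integral_noteq_infinite)
      then have "AE t in lebesgue. 0 < t \<longrightarrow> B x t < \<infinity>"
      proof (intro AE_completion, eventually_elim)
        case (elim t)
        then show ?case by (cases "B x t") (auto simp: ennreal_top_mult)
      qed
      then show ?thesis
        using elim(1) by eventually_elim (auto intro!: integrableI_bounded)
    qed
    ultimately show ?case
      unfolding frac_integral_converges_def set_integrable_def by blast
  qed
qed

end

section \<open>Boundedness on amalgam spaces\<close>

context A1q_weight
begin

text \<open>The function of the centre whose outer norm is taken in the amalgam norm with p = 1. An
  ordinary real power suffices, since w^q of a ball is positive and finite.\<close>

definition amalgam_term :: "real \<Rightarrow> ('a \<Rightarrow> complex) \<Rightarrow> real \<Rightarrow> 'a \<Rightarrow> ennreal" where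
  "amalgam_term e f r y = ennreal (V y r powr e) *
     (\<integral>\<^sup>+x\<in>ball y r. ennreal (norm (f x)) * ennreal (w x) \<partial>lebesgue)"

text \<open>Both factors are functions of measures of balls: of w^q dx, and of |f| w dx.\<close>

lemma borel_measurable_amalgam_term:
  assumes [measurable]: "f \<in> borel_measurable lebesgue"
  shows "amalgam_term e f r \<in> borel_measurable lebesgue"
proof -
  let ?D = "density lebesgue (\<lambda>x. ennreal (norm (f x)) * ennreal (w x))"
  have [measurable]: "(\<lambda>y. emeasure M (ball y r)) \<in> borel_measurable borel"
    "(\<lambda>y. emeasure ?D (ball y r)) \<in> borel_measurable borel"
    by (rule borel_measurable_emeasure_ball; auto)+
  have "amalgam_term e f r = (\<lambda>y. ennreal (enn2real (emeasure M (ball y r)) powr e) * emeasure ?D (ball y r))"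
    by (simp add: amalgam_term_def fun_eq_iff measure_def emeasure_density)
  moreover have "\<dots> \<in> borel_measurable borel" by measurable
  ultimately show ?thesis by (intro measurable_completion) simp
qed

lemma amalgam_norm_eq_SUP:
  assumes [measurable]: "f \<in> borel_measurable lebesgue"
  shows "amalgam_norm 1 s \<alpha> w (\<lambda>x. w x powr q) \<mu> f
    = (SUP r\<in>{0<..}. Lp_norm \<mu> s (amalgam_term (1 / \<alpha> - 1 - enn2real (1 / s)) f r))"
proof -
  have "Lp_norm w (ennreal 1) (\<lambda>x. ennreal (norm (indicat_real (ball y r) x *\<^sub>R f x)))
      = (\<integral>\<^sup>+x\<in>ball y r. ennreal (norm (f x)) * ennreal (w x) \<partial>lebesgue)" for y r
  proof -
    have "Lp_norm w (ennreal 1) (\<lambda>x. ennreal (norm (indicat_real (ball y r) x *\<^sub>R f x)))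
      = (\<integral>\<^sup>+x. ennreal (norm (indicat_real (ball y r) x *\<^sub>R f x)) \<partial>wmeasure w)"
      by (subst Lp_norm_ennreal) auto
    also have "\<dots> = (\<integral>\<^sup>+x. ennreal (w x) * ennreal (norm (indicat_real (ball y r) x *\<^sub>R f x)) \<partial>lebesgue)"
      unfolding wmeasure_def by (rule nn_integral_density) measurable
    also have "\<dots> = (\<integral>\<^sup>+x\<in>ball y r. ennreal (norm (f x)) * ennreal (w x) \<partial>lebesgue)"
      by (intro nn_integral_cong) (auto simp: indicator_def mult_ac)
    finally show ?thesis .
  qed
  then show ?thesis
    unfolding amalgam_norm_def
    by (intro SUP_cong refl arg_cong[where f = "Lp_norm \<mu> s"] ext)
      (simp add: amalgam_term_def emeasure_M_ball epowr_ennreal V_pos)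
qed

text \<open>The constant is fixed before \<open>\<mu>\<close> and f. For the bound, superlevel sets
  of the fractional integral at level l lie in those of the potential at level l/c', where the local
  estimate applies. For the convergence, the same estimate is used at one centre whose right sides
  are finite for an exhausting sequence of balls.\<close>

lemma frac_integral_amalgam_bounded:
  assumes p: "(\<lambda>(t, x, y). p t x y) \<in> borel_measurable (lebesgue_on ({0<..} \<times> UNIV))"
    and gauss: "\<And>t x y. 0 < t \<Longrightarrow> norm (p t x y) \<le> C\<^sub>0 * t powr (- n / 2) * exp (- A * (norm (x - y))\<^sup>2 / t)"
    and C\<^sub>0: "0 < C\<^sub>0" and A: "0 < A" and \<alpha>: "1 \<le> \<alpha>" "\<alpha> < \<beta>" and \<beta>: "1 / \<beta> = 1 / \<alpha> - \<gamma> / n"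
    and s: "ennreal \<beta> < s"
  obtains C where "0 < C"
    "\<And>(\<mu> :: 'a \<Rightarrow> real) f. f \<in> borel_measurable lebesgue \<Longrightarrow>
       weak_amalgam_norm q s \<beta> (\<lambda>x. w x powr q) \<mu> (frac_integral p \<gamma> f)
         \<le> ennreal C * amalgam_norm 1 s \<alpha> w (\<lambda>x. w x powr q) \<mu> f"
    "\<And>(\<mu> :: 'a \<Rightarrow> real) f. f \<in> borel_measurable lebesgue \<Longrightarrow> weight \<mu> \<Longrightarrow> \<not> (AE x in lebesgue. \<mu> x = 0) \<Longrightarrow>
       amalgam_norm 1 s \<alpha> w (\<lambda>x. w x powr q) \<mu> f < \<infinity> \<Longrightarrow> AE x in lebesgue. frac_integral_converges p \<gamma> f x"
proof -
  define e where "e = 1 / \<alpha> - 1 - enn2real (1 / s)"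
  have s0: "0 < s" using s by (rule le_less_trans[rotated]) simp
  have inv_s: "0 \<le> enn2real (1 / s)" "enn2real (1 / s) < 1 / \<beta>"
  proof -
    show "enn2real (1 / s) < 1 / \<beta>"
    proof (cases s)
      case (real t)
      then have "\<beta> < t" using s \<alpha> by (simp add: ennreal_less_iff)
      then have "1 / ennreal t = ennreal (1 / t)" using \<alpha> by (simp add: divide_ennreal flip: ennreal_1)
      then show ?thesis using real \<open>\<beta> < t\<close> \<alpha> by (simp add: frac_less2)
    qed (use \<alpha> in simp)
  qed simp
  \<comment> \<open>The source and the target norm carry the same power of w^q(B); consequently e +
    1/q = 1/\<beta> - 1/s is positive.\<close>
  have eq_q: "e = 1 / \<beta> - 1 / q - enn2real (1 / s)" by (simp add: e_def \<beta> inverse_q)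
  have e: "e \<le> 0" "0 < e + 1 / q"
  proof -
    have "1 / \<alpha> \<le> 1" using \<alpha> by simp
    then show "e \<le> 0" using inv_s(1) unfolding e_def by linarith
    show "0 < e + 1 / q" using inv_s(2) by (simp add: eq_q)
  qed
  obtain C\<^sub>1 \<rho> where C\<^sub>1: "0 < C\<^sub>1" "0 < \<rho>" "\<rho> < 1" and est:
    "\<And>g z r l. g \<in> borel_measurable lebesgue \<Longrightarrow> 0 < r \<Longrightarrow> 0 \<le> l \<Longrightarrow>
      ennreal (l * measure M {x \<in> ball z r. ennreal l < riesz_potential (\<gamma> - n) g x} powr (1 / q) * V z r powr e)
      \<le> ennreal C\<^sub>1 * (\<Sum>j. ennreal (\<rho> ^ j) * (ennreal (V z (2 ^ Suc j * r) powr e)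
           * (\<integral>\<^sup>+y\<in>ball z (2 ^ Suc j * r). g y * ennreal (w y) \<partial>lebesgue)))"
    using weak_local_estimate[OF e] by blast
  let ?P = "\<lambda>f. riesz_potential (\<gamma> - n) (\<lambda>y. ennreal (norm (f y :: complex)))"
  have est': "ennreal (l * measure M {x \<in> ball z r. ennreal l < ?P f x} powr (1 / q) * V z r powr e)
      \<le> ennreal C\<^sub>1 * (\<Sum>j. ennreal (\<rho> ^ j) * amalgam_term e f (2 ^ Suc j * r) z)"
    if [measurable]: "f \<in> borel_measurable lebesgue" and "0 < r" "0 \<le> l" for f z r l
    unfolding amalgam_term_def using that(2,3) by (intro est) auto
  let ?I = "\<lambda>f x. \<integral>\<^sup>+t\<in>{0<..}. (\<integral>\<^sup>+y. ennreal (norm (p t x y * f y)) \<partial>lebesgue) * ennreal (t powr (\<gamma> / 2 - 1)) \<partial>lebesgue"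
  obtain c where c: "0 < c" "\<And>f x. f \<in> borel_measurable lebesgue \<Longrightarrow> ?I f x \<le> ennreal c * ?P f x"
  proof -
    obtain c where c: "0 < c" "\<And>(p :: real \<Rightarrow> 'a \<Rightarrow> 'a \<Rightarrow> complex) f x.
      (\<And>t x y. 0 < t \<Longrightarrow> norm (p t x y) \<le> C\<^sub>0 * t powr (- real DIM('a) / 2) * exp (- A * (norm (x - y))\<^sup>2 / t)) \<Longrightarrow>
      f \<in> borel_measurable lebesgue \<Longrightarrow>
      (\<integral>\<^sup>+t\<in>{0<..}. (\<integral>\<^sup>+y. ennreal (norm (p t x y * f y)) \<partial>lebesgue) * ennreal (t powr (\<gamma> / 2 - 1)) \<partial>lebesgue)
        \<le> ennreal c * riesz_potential (\<gamma> - real DIM('a)) (\<lambda>y. ennreal (norm (f y))) x"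
      using nn_integral_kernel_le_riesz_potential[where 'a = 'a, of \<gamma> A C\<^sub>0] \<gamma>_pos \<gamma>_less A C\<^sub>0
      unfolding n_eq by blast
    show ?thesis using that[OF c(1)] c(2)[OF gauss[unfolded n_eq]] unfolding n_eq by blast
  qed
  \<comment> \<open>Adding 1 makes the constant positive without any information on the Gamma value;
    levels are divided by it later.\<close>
  define c' where "c' = (\<bar>1 / Gamma (\<gamma> / 2)\<bar> + 1) * c"
  have c': "0 < c'" using c(1) by (simp add: c'_def add_nonneg_pos)
  have frac_le: "ennreal (norm (frac_integral p \<gamma> f x)) \<le> ennreal c' * ?P f x"
    if "f \<in> borel_measurable lebesgue" for f x
  proof -
    have "ennreal (norm (frac_integral p \<gamma> f x)) \<le> ennreal \<bar>1 / Gamma (\<gamma> / 2)\<bar> * ?I f x"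
      by (rule norm_frac_integral_le)
    also have "\<dots> \<le> ennreal (\<bar>1 / Gamma (\<gamma> / 2)\<bar> + 1) * (ennreal c * ?P f x)"
      by (intro mult_mono ennreal_leI c(2) that) auto
    also have "\<dots> = ennreal c' * ?P f x"
      using c(1) by (simp add: c'_def ennreal_mult mult.assoc)
    finally show ?thesis .
  qed
  have cC: "0 < c' * C\<^sub>1" using c' C\<^sub>1(1) by simp
  have "\<exists>C>0. \<forall>(\<mu> :: 'a \<Rightarrow> real) F a N. F \<in> borel_measurable lebesgue \<longrightarrow>
       (\<forall>j. a j \<in> borel_measurable lebesgue) \<longrightarrow>
       (\<forall>y. F y \<le> ennreal (c' * C\<^sub>1) * (\<Sum>j. ennreal (\<rho> ^ j) * a j y)) \<longrightarrow>
       (\<forall>j. Lp_norm \<mu> s (a j) \<le> N) \<longrightarrow> Lp_norm \<mu> s F \<le> ennreal C * N"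
  proof (rule Lp_norm_geometric_sum[where 'a = 'a, OF s0 cC C\<^sub>1(2,3)], intro exI conjI allI impI)
    fix C' :: real assume "0 < C'" then show "0 < C'" .
  qed blast
  then obtain C where C: "0 < C" and geom:
    "\<And>(\<mu> :: 'a \<Rightarrow> real) F a N. F \<in> borel_measurable lebesgue \<Longrightarrow>
       (\<And>j. a j \<in> borel_measurable lebesgue) \<Longrightarrow>
       (\<And>y. F y \<le> ennreal (c' * C\<^sub>1) * (\<Sum>j. ennreal (\<rho> ^ j) * a j y)) \<Longrightarrow>
       (\<And>j. Lp_norm \<mu> s (a j) \<le> N) \<Longrightarrow> Lp_norm \<mu> s F \<le> ennreal C * N"
    by blast
  have term_le: "Lp_norm \<mu> s (amalgam_term e f r) \<le> amalgam_norm 1 s \<alpha> w (\<lambda>x. w x powr q) \<mu> f"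
    if "f \<in> borel_measurable lebesgue" "0 < r" for f r and \<mu> :: "'a \<Rightarrow> real"
    using that unfolding amalgam_norm_eq_SUP[OF that(1)] e_def[symmetric] by (intro SUP_upper) auto
  have bounded: "weak_amalgam_norm q s \<beta> (\<lambda>x. w x powr q) \<mu> (frac_integral p \<gamma> f)
         \<le> ennreal C * amalgam_norm 1 s \<alpha> w (\<lambda>x. w x powr q) \<mu> f"
    if f [measurable]: "f \<in> borel_measurable lebesgue" for f and \<mu> :: "'a \<Rightarrow> real"
    unfolding weak_amalgam_norm_def eq_q[symmetric]
  proof (rule SUP_least)
    fix r :: real assume "r \<in> {0<..}"
    then have r: "0 < r" by simp
    let ?h = "frac_integral p \<gamma> f"
    let ?F = "\<lambda>y. epowr (emeasure M (ball y r)) e * weak_Lp_norm (\<lambda>x. w x powr q) q (\<lambda>x. indicat_real (ball y r) x *\<^sub>R ?h x)"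
    have [measurable]: "?h \<in> borel_measurable lebesgue"
      by (rule borel_measurable_frac_integral[OF p f])
    have [measurable]: "(\<lambda>y. emeasure M (ball y r)) \<in> borel_measurable borel"
      by (rule borel_measurable_emeasure_ball) auto
    have [measurable]: "(\<lambda>y. weak_Lp_norm (\<lambda>x. w x powr q) q (\<lambda>x. indicat_real (ball y r) x *\<^sub>R ?h x)) \<in> borel_measurable borel"
      using q_gt_1 by (intro borel_measurable_weak_Lp_norm_ball) auto
    have "?F \<in> borel_measurable borel" by measurable
    then have F: "?F \<in> borel_measurable lebesgue" by (intro measurable_completion) simp
    have F_le: "?F y \<le> ennreal (c' * C\<^sub>1) * (\<Sum>j. ennreal (\<rho> ^ j) * amalgam_term e f (2 ^ Suc j * r) y)" for y
    proof -
      have "?F y = (SUP l\<in>{0<..}. ennreal (V y r powr e) * (ennreal l *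
          epowr (emeasure M {x. l < norm (indicat_real (ball y r) x *\<^sub>R ?h x)}) (1 / q)))"
        unfolding weak_Lp_norm_def using V_pos[OF r, of y]
        by (simp add: emeasure_M_ball epowr_ennreal SUP_mult_left_ennreal)
      also have "\<dots> \<le> ennreal (c' * C\<^sub>1) * (\<Sum>j. ennreal (\<rho> ^ j) * amalgam_term e f (2 ^ Suc j * r) y)"
      proof (rule SUP_least)
        fix l :: real assume "l \<in> {0<..}"
        then have l: "0 < l" by simp
        let ?E = "{x \<in> ball y r. ennreal (l / c') < ?P f x}"
        have "{x \<in> space lebesgue. x \<in> ball y r \<and> ennreal (l / c') < ?P f x} \<in> sets lebesgue"
          by measurable
        then have E: "?E \<in> sets lebesgue" by simp
        have "emeasure M ?E \<le> emeasure M (ball y r)" by (intro emeasure_mono) auto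
        then have "emeasure M ?E < \<infinity>" using emeasure_M_ball_finite by (rule le_less_trans)
        then have ME: "emeasure M ?E = ennreal (measure M ?E)" by (intro emeasure_eq_ennreal_measure) auto
        have "{x. l < norm (indicat_real (ball y r) x *\<^sub>R ?h x)} \<subseteq> ?E"
        proof
          fix x assume "x \<in> {x. l < norm (indicat_real (ball y r) x *\<^sub>R ?h x)}"
          then have x: "x \<in> ball y r" "l < norm (?h x)" using l by (cases "x \<in> ball y r"; simp)+
          then have "ennreal l < ennreal c' * ?P f x"
            using frac_le[OF f, of x] l by (intro less_le_trans[OF _ frac_le[OF f]]) (simp add: ennreal_less_iff)
          have "ennreal (l / c') < ?P f x"
          proof (rule ccontr)
            assume "\<not> ?thesis"
            then have "ennreal c' * ?P f x \<le> ennreal c' * ennreal (l / c')"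
              by (intro mult_left_mono) auto
            also have "\<dots> = ennreal l" using c' l by (simp flip: ennreal_mult)
            finally show False using \<open>ennreal l < ennreal c' * ?P f x\<close> by simp
          qed
          with x show "x \<in> ?E" by simp
        qed
        then have "emeasure M {x. l < norm (indicat_real (ball y r) x *\<^sub>R ?h x)} \<le> emeasure M ?E"
          by (rule emeasure_mono) (simp only: sets_wmeasure E)
        then have "epowr (emeasure M {x. l < norm (indicat_real (ball y r) x *\<^sub>R ?h x)}) (1 / q)
            \<le> epowr (emeasure M ?E) (1 / q)"
          using q_gt_1 by (intro epowr_mono) auto
        also have "\<dots> = ennreal (measure M ?E powr (1 / q))"
          unfolding ME using q_gt_1 by (intro epowr_ennreal_nonneg) auto
        finally have "ennreal (V y r powr e) * (ennreal l * epowr (emeasure M {x. l < norm (indicat_real (ball y r) x *\<^sub>R ?h x)}) (1 / q))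
            \<le> ennreal (V y r powr e) * (ennreal l * ennreal (measure M ?E powr (1 / q)))"
          by (intro mult_left_mono) auto
        also have "\<dots> = ennreal c' * ennreal (l / c' * measure M ?E powr (1 / q) * V y r powr e)"
          using l c' by (simp add: mult_ac flip: ennreal_mult)
        also have "\<dots> \<le> ennreal c' * (ennreal C\<^sub>1 * (\<Sum>j. ennreal (\<rho> ^ j) * amalgam_term e f (2 ^ Suc j * r) y))"
          using l c' r by (intro mult_left_mono est') auto
        also have "\<dots> = ennreal (c' * C\<^sub>1) * (\<Sum>j. ennreal (\<rho> ^ j) * amalgam_term e f (2 ^ Suc j * r) y)"
          using c' C\<^sub>1(1) by (subst ennreal_mult) (auto simp: mult.assoc)
        finally show "ennreal (V y r powr e) * (ennreal l * epowr (emeasure M {x. l < norm (indicat_real (ball y r) x *\<^sub>R ?h x)}) (1 / q))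
            \<le> ennreal (c' * C\<^sub>1) * (\<Sum>j. ennreal (\<rho> ^ j) * amalgam_term e f (2 ^ Suc j * r) y)" .
      qed
      finally show ?thesis .
    qed
    show "Lp_norm \<mu> s ?F \<le> ennreal C * amalgam_norm 1 s \<alpha> w (\<lambda>x. w x powr q) \<mu> f"
      by (rule geom[OF F borel_measurable_amalgam_term[OF f] F_le]) (use r in \<open>auto intro: term_le f\<close>)
  qed
  have converges: "AE x in lebesgue. frac_integral_converges p \<gamma> f x"
    if f [measurable]: "f \<in> borel_measurable lebesgue" and \<mu>: "weight \<mu>" "\<not> (AE x in lebesgue. \<mu> x = 0)"
      and fin: "amalgam_norm 1 s \<alpha> w (\<lambda>x. w x powr q) \<mu> f < \<infinity>" for f and \<mu> :: "'a \<Rightarrow> real"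
  proof -
    \<comment> \<open>The right side of the local estimate for the radius k+1. The bound for
      geometric sums applies to it directly, with equality as its pointwise hypothesis.\<close>
    let ?G = "\<lambda>k y. ennreal (c' * C\<^sub>1) * (\<Sum>j. ennreal (\<rho> ^ j) * amalgam_term e f (2 ^ Suc j * real (Suc k)) y)"
    note [measurable] = borel_measurable_amalgam_term[OF f]
    have G: "?G k \<in> borel_measurable lebesgue" for k by measurable
    have AE_G: "AE y in wmeasure \<mu>. \<forall>k. ?G k y < \<infinity>"
    proof (subst AE_all_countable, rule allI)
      fix k
      have "Lp_norm \<mu> s (?G k) \<le> ennreal C * amalgam_norm 1 s \<alpha> w (\<lambda>x. w x powr q) \<mu> f"
        by (rule geom[OF G borel_measurable_amalgam_term[OF f] order_refl]) (auto intro: term_le f)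
      also have "\<dots> < \<infinity>" using fin by (simp add: ennreal_mult_less_top)
      finally show "AE y in wmeasure \<mu>. ?G k y < \<infinity>"
        by (rule AE_finite_of_Lp_norm[OF G s0])
    qed
    \<comment> \<open>Here the nontriviality of \<open>\<mu>\<close> is used. A single centre is
      enough, because its balls of radius k+1 exhaust the space.\<close>
    have "\<exists>y. \<forall>k. ?G k y < \<infinity>"
    proof (rule ccontr)
      assume none: "\<not> ?thesis"
      have "AE y in wmeasure \<mu>. False"
        using AE_G by (rule eventually_mono) (use none in blast)
      then show False using AE_wmeasure_False[OF \<mu>(1)] \<mu>(2) by blast
    qed
    then obtain y where y: "\<And>k. ?G k y < \<infinity>" by blast
    have "AE x in lebesgue. \<forall>k. x \<in> ball y (real (Suc k)) \<longrightarrow> ?P f x < \<infinity>"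
    proof (subst AE_all_countable, rule allI)
      fix k :: nat
      let ?r = "real (Suc k)"
      let ?Z = "{x \<in> ball y ?r. ?P f x = \<infinity>}"
      have "{x \<in> space lebesgue. x \<in> ball y ?r \<and> ?P f x = \<infinity>} \<in> sets lebesgue" by measurable
      then have Z: "?Z \<in> sets lebesgue" by simp
      have "emeasure M ?Z \<le> emeasure M (ball y ?r)" by (intro emeasure_mono) auto
      then have "emeasure M ?Z < \<infinity>" using emeasure_M_ball_finite by (rule le_less_trans)
      then have MZ: "emeasure M ?Z = ennreal (measure M ?Z)" by (intro emeasure_eq_ennreal_measure) auto
      have "ennreal C\<^sub>1 * (\<Sum>j. ennreal (\<rho> ^ j) * amalgam_term e f (2 ^ Suc j * ?r) y) < \<infinity>"
        using y[of k] c' C\<^sub>1(1) by (auto simp: ennreal_mult_less_top)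
      moreover define G where "G = enn2real (ennreal C\<^sub>1 * (\<Sum>j. ennreal (\<rho> ^ j) * amalgam_term e f (2 ^ Suc j * ?r) y))"
      ultimately have G: "0 \<le> G"
        "ennreal C\<^sub>1 * (\<Sum>j. ennreal (\<rho> ^ j) * amalgam_term e f (2 ^ Suc j * ?r) y) = ennreal G"
        unfolding G_def by (simp_all only: enn2real_nonneg ennreal_enn2real infinity_ennreal_def)
      have "measure M ?Z = 0"
      proof (rule ccontr)
        assume "measure M ?Z \<noteq> 0"
        then have "0 < measure M ?Z powr (1 / q) * V y ?r powr e"
          using V_pos[of ?r y] by (simp add: zero_less_measure_iff)
        define b where "b = measure M ?Z powr (1 / q) * V y ?r powr e"
        have b: "0 < b" unfolding b_def by fact
        \<comment> \<open>The local estimate gives l b \<le> G for every level l, as the infinity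
          set lies in every superlevel set; this level violates it.\<close>
        define l where "l = (G + 1) / b"
        have l: "0 \<le> l" using G(1) b by (simp add: l_def)
        let ?E = "{x \<in> ball y ?r. ennreal l < ?P f x}"
        have "{x \<in> space lebesgue. x \<in> ball y ?r \<and> ennreal l < ?P f x} \<in> sets lebesgue" by measurable
        then have E: "?E \<in> sets lebesgue" by simp
        have "emeasure M ?E \<le> emeasure M (ball y ?r)" by (intro emeasure_mono) auto
        then have fin_E: "emeasure M ?E < \<infinity>" using emeasure_M_ball_finite by (rule le_less_trans)
        have "?Z \<subseteq> ?E" by auto
        then have "emeasure M ?Z \<le> emeasure M ?E" by (rule emeasure_mono) (simp only: sets_wmeasure E)
        then have "measure M ?Z \<le> measure M ?E"
          unfolding measure_def using fin_E by (intro enn2real_mono) auto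
        then have "l * b \<le> l * measure M ?E powr (1 / q) * V y ?r powr e"
          unfolding b_def mult.assoc using l q_gt_1 by (intro mult_left_mono mult_right_mono powr_mono2) auto
        also have "\<dots> \<le> G"
          using est'[OF f _ l, of ?r y] G by (simp only: G(2) ennreal_le_iff)
        finally show False using b by (simp add: l_def)
      qed
      then have "?Z \<in> null_sets M" using MZ Z by (auto simp: null_sets_def)
      then have "AE x in M. x \<notin> ?Z" by (rule AE_not_in)
      \<comment> \<open>Null sets of w^q dx are Lebesgue null because w > 0 almost
        everywhere.\<close>
      then have "AE x in lebesgue. 0 < ennreal (w x powr q) \<longrightarrow> x \<notin> ?Z"
        unfolding wmeasure_def by (subst (asm) AE_density) auto
      with AE_V_le show "AE x in lebesgue. x \<in> ball y ?r \<longrightarrow> ?P f x < \<infinity>"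
        by eventually_elim (auto simp: less_top)
    qed
    then have "AE x in lebesgue. ?I f x < \<infinity>"
    proof eventually_elim
      case (elim x)
      obtain k :: nat where "dist y x < real k" using reals_Archimedean2 by blast
      then have "x \<in> ball y (real (Suc k))" by simp
      then have "?P f x < \<infinity>" using elim by blast
      then have "ennreal c * ?P f x < \<infinity>" by (simp add: ennreal_mult_less_top)
      then show ?case using c(2)[OF f, of x] by (rule le_less_trans[rotated])
    qed
    then show ?thesis by (rule AE_frac_integral_converges[OF p f])
  qed
  show ?thesis using that[OF C bounded converges] .
qed

end

text \<open>The second conjunct guards against default values of divergent integrals: the norm
  inequality speaks about the actual operator. Its nontriviality conditions are natural, since for a
  vanishing weight w or \<open>\<mu>\<close> the source norm is 0 for every locally integrable f and
  controls nothing.\<close>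

theorem corollary3p4:
  fixes D :: "((real ^ 'n) \<Rightarrow> complex) set"
    and L :: "((real ^ 'n) \<Rightarrow> complex) \<Rightarrow> ((real ^ 'n) \<Rightarrow> complex)"
    and S :: "real \<Rightarrow> ((real ^ 'n) \<Rightarrow> complex) \<Rightarrow> ((real ^ 'n) \<Rightarrow> complex)"
    and p :: "real \<Rightarrow> real ^ 'n \<Rightarrow> real ^ 'n \<Rightarrow> complex"
    and w \<mu> :: "real ^ 'n \<Rightarrow> real"
    and C\<^sub>0 A \<gamma> q \<alpha> \<beta> :: real
    and s :: ennreal
  assumes "L2_linear_operator D L"
    and "analytic_semigroup S"
    and "generates D L S"
    and "semigroup_kernel S p"
    and "0 < C\<^sub>0" and "0 < A"
    and "\<And>t x y. 0 < t \<Longrightarrow>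
           norm (p t x y) \<le> C\<^sub>0 * t powr (- real CARD('n) / 2) * exp (- A * (norm (x - y))\<^sup>2 / t)"
    and "0 < \<gamma>" and "\<gamma> < real CARD('n)"
    and "q = real CARD('n) / (real CARD('n) - \<gamma>)"
    and "w \<in> A1_class q"
    and "1 \<le> \<alpha>" and "\<alpha> < \<beta>" and "ennreal \<beta> < s"
    and "1 / \<beta> = 1 / \<alpha> - \<gamma> / real CARD('n)"
    and "\<mu> \<in> doubling_class"
  shows "(\<exists>C>0. \<forall>f \<in> amalgam_space 1 s \<alpha> w (\<lambda>x. w x powr q) \<mu>.
            frac_integral p \<gamma> f \<in> weak_amalgam_space q s \<beta> (\<lambda>x. w x powr q) \<mu> \<and>
            weak_amalgam_norm q s \<beta> (\<lambda>x. w x powr q) \<mu> (frac_integral p \<gamma> f)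
              \<le> ennreal C * amalgam_norm 1 s \<alpha> w (\<lambda>x. w x powr q) \<mu> f) \<and>
         (\<not> (AE x in lebesgue. w x = 0) \<and> \<not> (AE x in lebesgue. \<mu> x = 0) \<longrightarrow>
            (\<forall>f \<in> amalgam_space 1 s \<alpha> w (\<lambda>x. w x powr q) \<mu>.
               AE x in lebesgue. frac_integral_converges p \<gamma> f x))"
proof -
  have pm: "(\<lambda>(t, x, y). p t x y) \<in> borel_measurable (lebesgue_on ({0<..} \<times> UNIV))"
    using assms(4) by (simp add: semigroup_kernel_def)
  have meas: "f \<in> borel_measurable lebesgue" if "f \<in> amalgam_space 1 s \<alpha> w (\<lambda>x. w x powr q) \<mu>" for f
    using that by (auto simp: amalgam_space_def intro: locally_integrable_measurable)
  have fin: "amalgam_norm 1 s \<alpha> w (\<lambda>x. w x powr q) \<mu> f < \<infinity>"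
    if "f \<in> amalgam_space 1 s \<alpha> w (\<lambda>x. w x powr q) \<mu>" for f
    using that by (simp add: amalgam_space_def)
  have n: "real CARD('n) = real DIM(real ^ 'n)" by simp
  have q: "0 < q" using assms(8-10) by simp
  show ?thesis
  proof (cases "AE x in lebesgue. w x = 0")
    \<comment> \<open>The target norm is 0 for every f, so any constant works, and the claim on
      convergence is vacuous.\<close>
    case True
    then have W: "AE x in lebesgue. w x powr q = 0" by eventually_elim simp
    have "0 < s" using \<open>ennreal \<beta> < s\<close> by (rule le_less_trans[rotated]) simp
    then have "weak_amalgam_norm q s \<beta> (\<lambda>x. w x powr q) \<mu> (frac_integral p \<gamma> f) = 0" for f
      using weak_amalgam_norm_zero_weight[OF W q] by blast
    then show ?thesis
      using True borel_measurable_frac_integral[OF pm meas]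
      by (auto simp: weak_amalgam_space_def intro!: exI[of _ 1])
  next
    case False
    obtain K where K: "0 < K" "\<And>z r. 0 < r \<Longrightarrow> \<exists>m>0. (AE x in lebesgue. x \<in> ball z r \<longrightarrow> m \<le> w x) \<and>
        emeasure (wmeasure (\<lambda>x. w x powr q)) (ball z r) \<le> ennreal (K * r powr real CARD('n) * m powr q)"
      using A1_class_lower_bound[OF \<open>w \<in> A1_class q\<close> q False] unfolding n by blast
    have w: "weight w" using \<open>w \<in> A1_class q\<close> by (simp add: A1_class_def)
    interpret A1q_weight w "real CARD('n)" \<gamma> q K
      using w K assms(8-10) by unfold_locales (auto simp: weight_def locally_integrable_measurable)
    have \<mu>: "weight \<mu>" using \<open>\<mu> \<in> doubling_class\<close> by (simp add: doubling_class_def)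
    obtain C where C: "0 < C"
      "\<And>f. f \<in> borel_measurable lebesgue \<Longrightarrow>
         weak_amalgam_norm q s \<beta> (\<lambda>x. w x powr q) \<mu> (frac_integral p \<gamma> f)
           \<le> ennreal C * amalgam_norm 1 s \<alpha> w (\<lambda>x. w x powr q) \<mu> f"
      "\<And>f. f \<in> borel_measurable lebesgue \<Longrightarrow> \<not> (AE x in lebesgue. \<mu> x = 0) \<Longrightarrow>
         amalgam_norm 1 s \<alpha> w (\<lambda>x. w x powr q) \<mu> f < \<infinity> \<Longrightarrow> AE x in lebesgue. frac_integral_converges p \<gamma> f x"
      using frac_integral_amalgam_bounded[OF pm assms(7,5,6,12,13,15,14)] \<mu> by metis
    have "frac_integral p \<gamma> f \<in> weak_amalgam_space q s \<beta> (\<lambda>x. w x powr q) \<mu>"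
      if f: "f \<in> amalgam_space 1 s \<alpha> w (\<lambda>x. w x powr q) \<mu>" for f
    proof -
      have "ennreal C * amalgam_norm 1 s \<alpha> w (\<lambda>x. w x powr q) \<mu> f < \<infinity>"
        using fin[OF f] by (simp add: ennreal_mult_less_top)
      then show ?thesis
        using borel_measurable_frac_integral[OF pm meas[OF f]] C(2)[OF meas[OF f]]
        by (auto simp: weak_amalgam_space_def intro: le_less_trans)
    qed
    then show ?thesis using C meas fin by blast
  qed
qed

end
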